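(* Let $L_s=-\partial^2+u_s$ be an algebro-geometric Schrödinger operator with spectral curve $\Gamma_s$. Let $\partial-\phi_s$ be the intrinsic right factor of $L_s-\lambda$ in $K(\Gamma_s)[\partial]$, and let $\Psi_s$ be a nonzero solution defined by the differential relation $\partial(\Psi_s)=\phi_s\Psi_s$. Then $K(\Gamma_s)\langle\Psi_s\rangle$ is a spectral Picard-Vessiot field over the curve $\Gamma_s$ of the equation $(L_s-\lambda)(\Psi)=0$.
   Context: $(\Sigma,\partial)$ is a differential field of characteristic zero whose field of constants $C$ is algebraically closed. An operator $L\in\Sigma[\partial]\setminus C[\partial]$ of order $n$ is algebro-geometric if some $P\in\Sigma[\partial]$ of order relatively prime to $n$ satisfies $[L,P]=0$. Let $L_s=-\partial^2+u_s$ with $u_s\in\Sigma\setminus C$ be algebro-geometric. Then there is a unique monic operator $A_{2s+1}$ of minimal order $2s+1$ (minimal among operators of the centralizer not in $C[L_s]$) such that the centralizer of $L_s$ in $\Sigma[\partial]$ is $C[L_s,A_{2s+1}]$ and $A_{2s+1}^2+R_{2s+1}(L_s)=0$ with $R_{2s+1}\in C[\lambda]$ of degree $2s+1$; $A_{2s+1}$ is the partner of $L_s$ and $s$ the level. $K=C\langle u_s\rangle$ is the differential subfield of $\Sigma$ generated by $C$ and $u_s$; $L_s,A_{2s+1}\in K[\partial]$. Let $\lambda,\mu$ be algebraic indeterminates over $K$ with $\partial\lambda=\partial\mu=0$. Put $f_s=\mu^2+R_{2s+1}(\lambda)$; the spectral curve $\Gamma_s\subset C^2$ is $f_s=0$.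 $C(\Gamma_s)$ and $K(\Gamma_s)$ are the fraction fields of the domains $C[\lambda,\mu]/(f_s)$ and $K[\lambda,\mu]/(f_s)$; the derivation of $K(\Gamma_s)$ (also written $\partial$) is induced by $\partial$ on $K[\lambda,\mu]$ acting on coefficients. The monic greatest common right divisor of $L_s-\lambda$ and $A_{2s+1}-\mu$ in $K(\Gamma_s)[\partial]$ has order one; it is written $\partial-\phi_s$ with $\phi_s\in K(\Gamma_s)$ and called the intrinsic right factor of $L_s-\lambda$. Solutions are taken in a differential closure of $K(\Gamma_s)$; $\langle\,\cdot\,\rangle$ denotes the generated differential field extension. A differential field extension $\mathcal{E}$ of $K(\Gamma_s)$ is a spectral Picard-Vessiot field over the curve $\Gamma_s$ of the equation $(L_s-\lambda)(\Psi)=0$ if (1) $\mathcal{E}=K(\Gamma_s)\langle\Psi_1,\Psi_2\rangle$ where $\{\Psi_1,\Psi_2\}$ is a fundamental set of solutions of $(L_s-\lambda)(\Psi)=0$, and (2) $\mathcal{E}$ and $K(\Gamma_s)$ have the same field of constants $C(\Gamma_s)$. *)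

theory Defs
  imports
    "HOL-Computational_Algebra.Polynomial"
    "HOL-Algebra.Indexed_Polynomials"
    "HOL-Algebra.Algebraic_Closure_Type"
begin

section \<open>Differential fields\<close>

class differential_field = field_char_0 +
  fixes der :: "'a \<Rightarrow> 'a"  (\<open>\<partial>\<close>)
  assumes der_add: "\<partial> (x + y) = \<partial> x + \<partial> y"
    and der_mult: "\<partial> (x * y) = \<partial> x * y + x * \<partial> y"

lemma der_0 [simp]: "\<partial> (0 :: 'a :: differential_field) = 0"
  using der_add[of 0 "0 :: 'a"] by simp

lemma der_1 [simp]: "\<partial> (1 :: 'a :: differential_field) = 0"
  using der_mult[of 1 "1 :: 'a"] by simp

definition constants :: "'a :: differential_field set \<Rightarrow> 'a set" where
  "constants S = {x \<in> S. \<partial> x = 0}"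

definition diff_subfield :: "'a :: differential_field set \<Rightarrow> bool" where
  "diff_subfield S \<longleftrightarrow> 0 \<in> S \<and> 1 \<in> S \<and>
     (\<forall>x\<in>S. \<forall>y\<in>S. x + y \<in> S \<and> x * y \<in> S) \<and>
     (\<forall>x\<in>S. - x \<in> S \<and> inverse x \<in> S \<and> \<partial> x \<in> S)"

definition diff_field_gen :: "'a :: differential_field set \<Rightarrow> 'a set" where
  "diff_field_gen S = diff_subfield hull S"

definition polys_over :: "'a :: zero set \<Rightarrow> 'a poly set" where
  "polys_over S = {p. \<forall>i. poly.coeff p i \<in> S}"

definition alg_closed_in_itself :: "'a :: Fields.field set \<Rightarrow> bool" where
  "alg_closed_in_itself F \<longleftrightarrow> (\<forall>p\<in>polys_over F. Polynomial.degree p > 0 \<longrightarrow> (\<exists>x\<in>F. poly p x = 0))"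


section \<open>Linear differential operators\<close>

text \<open>The operator \<open>a\<^sub>0 + a\<^sub>1 \<partial> + \<dots> + a\<^sub>n \<partial>\<^sup>n\<close> is stored as the polynomial with these
  coefficients; only the multiplication differs from that of \<open>poly\<close>.\<close>

typedef (overloaded) ('a :: differential_field) diff_op = "UNIV :: 'a poly set"
  morphisms op_poly Op
  by simp

setup_lifting type_definition_diff_op

text \<open>Left multiplication by \<open>\<partial>\<close>, from \<open>\<partial> \<cdot> (a \<partial>\<^sup>i) = \<partial>(a) \<partial>\<^sup>i + a \<partial>\<^sup>i\<^sup>+\<^sup>1\<close>.\<close>
definition der_shift :: "'a :: differential_field poly \<Rightarrow> 'a poly" where
  "der_shift p = map_poly \<partial> p + pCons 0 p"

definition op_mult :: "'a :: differential_field poly \<Rightarrow> 'a poly \<Rightarrow> 'a poly" where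
  "op_mult p q = (\<Sum>i\<le>Polynomial.degree p. Polynomial.smult (poly.coeff p i) ((der_shift ^^ i) q))"

lemma op_mult_bound:
  assumes "Polynomial.degree p \<le> n"
  shows "op_mult p q = (\<Sum>i\<le>n. Polynomial.smult (poly.coeff p i) ((der_shift ^^ i) q))"
  unfolding op_mult_def using assms
  by (intro sum.mono_neutral_left) (auto simp: coeff_eq_0)

lemma der_shift_add: "der_shift (p + q) = der_shift p + der_shift q"
  by (rule poly_eqI) (simp add: der_shift_def coeff_map_poly coeff_pCons der_add split: nat.split)

lemma der_shift_0 [simp]: "der_shift 0 = 0"
  by (simp add: der_shift_def)

lemma der_shift_sum: "der_shift (sum f A) = (\<Sum>i\<in>A. der_shift (f i))"
  by (induction A rule: infinite_finite_induct) (auto simp: der_shift_add)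

lemma der_shift_smult:
  "der_shift (Polynomial.smult a p) = Polynomial.smult (\<partial> a) p + Polynomial.smult a (der_shift p)"
  by (rule poly_eqI)
     (simp add: der_shift_def coeff_map_poly coeff_pCons der_mult algebra_simps split: nat.split)

lemma der_shift_pow_add: "(der_shift ^^ i) (p + q) = (der_shift ^^ i) p + (der_shift ^^ i) q"
  by (induction i) (auto simp: der_shift_add)

lemma op_mult_add_right: "op_mult p (q + r) = op_mult p q + op_mult p r"
  by (simp add: op_mult_def der_shift_pow_add smult_add_right sum.distrib)

lemma op_mult_add_left: "op_mult (p + q) r = op_mult p r + op_mult q r"
proof -
  define n where "n = max (Polynomial.degree p) (Polynomial.degree q)"
  have "Polynomial.degree (p + q) \<le> n" "Polynomial.degree p \<le> n" "Polynomial.degree q \<le> n"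
    by (auto simp: n_def degree_add_le)
  thus ?thesis
    by (simp add: op_mult_bound[of _ n] smult_add_left sum.distrib)
qed

lemma op_mult_0_left [simp]: "op_mult 0 q = 0"
  by (simp add: op_mult_def)

lemma op_mult_0_right [simp]: "op_mult p 0 = 0"
  using op_mult_add_right[of p 0 0] by simp

lemma op_mult_sum_left: "op_mult (sum f A) q = (\<Sum>i\<in>A. op_mult (f i) q)"
  by (induction A rule: infinite_finite_induct) (auto simp: op_mult_add_left)

lemma smult_sum_right: "Polynomial.smult a (sum f A) = (\<Sum>i\<in>A. Polynomial.smult a (f i))"
  by (induction A rule: infinite_finite_induct) (auto simp: smult_add_right)

lemma op_mult_smult_left: "op_mult (Polynomial.smult a p) q = Polynomial.smult a (op_mult p q)"
  by (simp add: op_mult_bound[of "Polynomial.smult a p" "Polynomial.degree p"] op_mult_def smult_sum_right)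

lemma op_mult_der_shift: "op_mult (der_shift p) q = der_shift (op_mult p q)"
proof -
  define n where "n = Polynomial.degree p"
  have 1: "op_mult (map_poly \<partial> p) q = (\<Sum>i\<le>n. Polynomial.smult (\<partial> (poly.coeff p i)) ((der_shift ^^ i) q))"
    using map_poly_degree_leq[of \<partial> p] by (simp add: op_mult_bound[of _ n] n_def coeff_map_poly)
  have "op_mult (pCons 0 p) q =
      (\<Sum>i\<le>Suc n. Polynomial.smult (poly.coeff (pCons 0 p) i) ((der_shift ^^ i) q))"
    by (intro op_mult_bound) (simp add: n_def degree_pCons_le)
  also have "\<dots> = (\<Sum>i\<le>n. Polynomial.smult (poly.coeff p i) ((der_shift ^^ Suc i) q))"
    by (subst sum.atMost_Suc_shift) (simp del: funpow.simps)
  finally have "op_mult (der_shift p) q =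
      (\<Sum>i\<le>n. Polynomial.smult (\<partial> (poly.coeff p i)) ((der_shift ^^ i) q)) +
      (\<Sum>i\<le>n. Polynomial.smult (poly.coeff p i) ((der_shift ^^ Suc i) q))"
    using 1 unfolding der_shift_def[of p] op_mult_add_left by metis
  thus ?thesis
    by (simp add: op_mult_def[of p] n_def der_shift_sum der_shift_smult sum.distrib)
qed

lemma op_mult_assoc: "op_mult (op_mult p q) r = op_mult p (op_mult q r)"
proof -
  have "op_mult ((der_shift ^^ i) q) r = (der_shift ^^ i) (op_mult q r)" for i
    by (induction i) (auto simp: op_mult_der_shift)
  thus ?thesis
    by (simp add: op_mult_def[of p] op_mult_sum_left op_mult_smult_left)
qed

lemma op_mult_1_left: "op_mult 1 q = q"
  by (simp add: op_mult_def)

lemma op_mult_1_right: "op_mult p 1 = p"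
proof -
  have "(der_shift ^^ i) 1 = (Polynomial.monom 1 i :: 'a poly)" for i
  proof (induction i)
    case (Suc i)
    have "map_poly \<partial> (Polynomial.monom (1 :: 'a) i) = 0"
      by (rule poly_eqI) (simp add: coeff_map_poly)
    thus ?case using Suc by (simp add: der_shift_def monom_Suc)
  qed simp
  thus ?thesis
    using poly_as_sum_of_monoms[of p] by (simp add: op_mult_def smult_monom)
qed

instantiation diff_op :: (differential_field) ring_1
begin
lift_definition zero_diff_op :: "'a diff_op" is 0 .
lift_definition one_diff_op :: "'a diff_op" is 1 .
lift_definition plus_diff_op :: "'a diff_op \<Rightarrow> 'a diff_op \<Rightarrow> 'a diff_op" is "(+)" .
lift_definition minus_diff_op :: "'a diff_op \<Rightarrow> 'a diff_op \<Rightarrow> 'a diff_op" is "(-)" .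
lift_definition uminus_diff_op :: "'a diff_op \<Rightarrow> 'a diff_op" is uminus .
lift_definition times_diff_op :: "'a diff_op \<Rightarrow> 'a diff_op \<Rightarrow> 'a diff_op" is op_mult .
instance
  by standard (transfer, simp add: op_mult_assoc op_mult_1_left op_mult_1_right
    op_mult_add_left op_mult_add_right)+
end

lift_definition op_const :: "'a :: differential_field \<Rightarrow> 'a diff_op" is "\<lambda>a. [:a:]" .
lift_definition op_D :: "'a :: differential_field diff_op" is "[:0, 1:]" .
lift_definition op_coeff :: "'a :: differential_field diff_op \<Rightarrow> nat \<Rightarrow> 'a" is poly.coeff .
lift_definition op_order :: "'a :: differential_field diff_op \<Rightarrow> nat" is Polynomial.degree .

text \<open>Coefficientwise image; meaningful if \<open>j 0 = 0\<close>.\<close>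
lift_definition map_op ::
  "('a :: differential_field \<Rightarrow> 'b :: differential_field) \<Rightarrow> 'a diff_op \<Rightarrow> 'b diff_op" is map_poly .

lemma op_D_const: "op_D * op_const a = op_const a * op_D + op_const (\<partial> a)"
  by transfer (simp add: op_mult_def der_shift_def map_poly_pCons)

definition op_apply :: "'a :: differential_field diff_op \<Rightarrow> 'a \<Rightarrow> 'a" where
  "op_apply P y = (\<Sum>i\<le>op_order P. op_coeff P i * (\<partial> ^^ i) y)"

lemma op_apply_bound:
  assumes "op_order P \<le> n"
  shows "op_apply P y = (\<Sum>i\<le>n. op_coeff P i * (\<partial> ^^ i) y)"
  unfolding op_apply_def using assms
  by (intro sum.mono_neutral_left) (auto simp: op_coeff.rep_eq op_order.rep_eq coeff_eq_0)

lemma op_apply_add: "op_apply (P + Q) y = op_apply P y + op_apply Q y"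
proof -
  define n where "n = max (op_order P) (op_order Q)"
  have "op_order (P + Q) \<le> n" "op_order P \<le> n" "op_order Q \<le> n"
    by (auto simp: n_def op_order.rep_eq plus_diff_op.rep_eq degree_add_le)
  thus ?thesis
    by (simp add: op_apply_bound[of _ n] op_coeff.rep_eq plus_diff_op.rep_eq
        sum.distrib distrib_right)
qed

lemma op_apply_sum: "op_apply (sum F A) y = (\<Sum>i\<in>A. op_apply (F i) y)"
proof (induction A rule: infinite_finite_induct)
qed (auto simp: op_apply_add, auto simp: op_apply_def op_coeff.rep_eq zero_diff_op.rep_eq)

lemma der_sum: "\<partial> (sum f A) = (\<Sum>i\<in>A. \<partial> (f i :: 'a :: differential_field))"
  by (induction A rule: infinite_finite_induct) (auto simp: der_add)

lemma op_apply_smult: "op_apply (Op (Polynomial.smult a (op_poly P))) y = a * op_apply P y"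
  by (subst op_apply_bound[of _ "op_order P"])
     (auto simp: op_apply_def op_coeff.rep_eq op_order.rep_eq Op_inverse sum_distrib_left mult.assoc)

lemma op_apply_der_shift: "op_apply (Op (der_shift (op_poly P))) y = \<partial> (op_apply P y)"
proof -
  define n where "n = op_order P"
  define c where "c = op_coeff P"
  have c0: "c (Suc n) = 0"
    by (simp add: c_def n_def op_coeff.rep_eq op_order.rep_eq coeff_eq_0)
  have "op_order (Op (der_shift (op_poly P))) \<le> Suc n"
    unfolding n_def op_order.rep_eq Op_inverse[OF UNIV_I] der_shift_def
    by (intro degree_add_le) (auto simp: degree_pCons_le intro: le_trans[OF map_poly_degree_leq])
  hence "op_apply (Op (der_shift (op_poly P))) y =
      (\<Sum>i\<le>Suc n. (\<partial> (c i) + (case i of 0 \<Rightarrow> 0 | Suc k \<Rightarrow> c k)) * (\<partial> ^^ i) y)"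
    by (simp add: op_apply_bound op_coeff.rep_eq Op_inverse der_shift_def coeff_map_poly
        coeff_pCons c_def del: sum.atMost_Suc cong: nat.case_cong)
  also have "\<dots> = (\<Sum>i\<le>Suc n. \<partial> (c i) * (\<partial> ^^ i) y) +
      (\<Sum>i\<le>Suc n. (case i of 0 \<Rightarrow> 0 | Suc k \<Rightarrow> c k) * (\<partial> ^^ i) y)"
    by (simp add: distrib_right sum.distrib del: sum.atMost_Suc)
  also have "(\<Sum>i\<le>Suc n. (case i of 0 \<Rightarrow> 0 | Suc k \<Rightarrow> c k) * (\<partial> ^^ i) y) =
      (\<Sum>i\<le>n. c i * (\<partial> ^^ Suc i) y)"
    by (subst sum.atMost_Suc_shift) simp
  also have "(\<Sum>i\<le>Suc n. \<partial> (c i) * (\<partial> ^^ i) y) = (\<Sum>i\<le>n. \<partial> (c i) * (\<partial> ^^ i) y)"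
    by (simp add: c0)
  finally show ?thesis
    by (simp add: op_apply_def der_sum der_mult sum.distrib n_def c_def)
qed

lemma op_apply_mult: "op_apply (P * Q) y = op_apply P (op_apply Q y)"
proof -
  have pow: "op_apply (Op ((der_shift ^^ i) (op_poly Q))) y = (\<partial> ^^ i) (op_apply Q y)" for i
  proof (induction i)
    case (Suc i)
    thus ?case
      using op_apply_der_shift[of "Op ((der_shift ^^ i) (op_poly Q))" y] by (simp add: Op_inverse)
  qed (simp add: op_poly_inverse)
  have "P * Q = (\<Sum>i\<le>op_order P. Op (Polynomial.smult (op_coeff P i) ((der_shift ^^ i) (op_poly Q))))"
  proof -
    have Op_sum: "Op (sum f A) = (\<Sum>i\<in>A. Op (f i))" for f :: "nat \<Rightarrow> 'a poly" and A
      by (induction A rule: infinite_finite_induct)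
         (auto simp: zero_diff_op_def plus_diff_op.abs_eq[symmetric])
    show ?thesis
      by (simp add: times_diff_op_def op_mult_def op_coeff.rep_eq op_order.rep_eq Op_sum)
  qed
  moreover have "op_apply (Op (Polynomial.smult a ((der_shift ^^ i) (op_poly Q)))) y =
      a * (\<partial> ^^ i) (op_apply Q y)" for a i
    using op_apply_smult[of a "Op ((der_shift ^^ i) (op_poly Q))" y] by (simp add: Op_inverse pow)
  ultimately show ?thesis
    by (simp add: op_apply_sum op_apply_def[of P])
qed

definition op_monic :: "'a :: differential_field diff_op \<Rightarrow> bool" where
  "op_monic P \<longleftrightarrow> op_coeff P (op_order P) = 1"

definition ops_over :: "'a :: differential_field set \<Rightarrow> 'a diff_op set" where
  "ops_over S = {P. \<forall>i. op_coeff P i \<in> S}"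

definition right_divides_over ::
  "'a :: differential_field set \<Rightarrow> 'a diff_op \<Rightarrow> 'a diff_op \<Rightarrow> bool" where
  "right_divides_over S G P \<longleftrightarrow> (\<exists>Q\<in>ops_over S. P = Q * G)"

definition monic_gcrd_over ::
  "'a :: differential_field set \<Rightarrow> 'a diff_op \<Rightarrow> 'a diff_op \<Rightarrow> 'a diff_op \<Rightarrow> bool" where
  "monic_gcrd_over S P Q G \<longleftrightarrow> G \<in> ops_over S \<and> op_monic G \<and>
     right_divides_over S G P \<and> right_divides_over S G Q \<and>
     (\<forall>H\<in>ops_over S. right_divides_over S H P \<and> right_divides_over S H Q \<longrightarrow>
        right_divides_over S H G)"

definition fundamental_set :: "'a :: differential_field diff_op \<Rightarrow> 'a set \<Rightarrow> bool" where
  "fundamental_set P Y \<longleftrightarrow> finite Y \<and> card Y = op_order P \<and> (\<forall>y\<in>Y. op_apply P y = 0) \<and>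
     (\<forall>c. (\<forall>y\<in>Y. c y \<in> constants UNIV) \<and> (\<Sum>y\<in>Y. c y * y) = 0 \<longrightarrow> (\<forall>y\<in>Y. c y = 0))"


section \<open>Algebro-geometric Schroedinger operators\<close>

definition centralizer :: "'a :: differential_field diff_op \<Rightarrow> 'a diff_op set" where
  "centralizer L = {P. L * P = P * L}"

definition algebro_geometric :: "'a :: differential_field diff_op \<Rightarrow> bool" where
  "algebro_geometric L \<longleftrightarrow> L \<notin> ops_over (constants UNIV) \<and>
     (\<exists>P\<in>centralizer L. P \<noteq> 0 \<and> coprime (op_order P) (op_order L))"

definition schroedinger :: "'a :: differential_field \<Rightarrow> 'a diff_op" where
  "schroedinger u = - (op_D ^ 2) + op_const u"

text \<open>The \<open>C\<close>-subalgebra generated by \<open>G\<close>, where \<open>C\<close> is the field of constants.\<close>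
inductive_set const_algebra :: "'a :: differential_field diff_op set \<Rightarrow> 'a diff_op set"
  for G :: "'a diff_op set" where
  const: "c \<in> constants UNIV \<Longrightarrow> op_const c \<in> const_algebra G"
| gen: "P \<in> G \<Longrightarrow> P \<in> const_algebra G"
| add: "P \<in> const_algebra G \<Longrightarrow> Q \<in> const_algebra G \<Longrightarrow> P + Q \<in> const_algebra G"
| mult: "P \<in> const_algebra G \<Longrightarrow> Q \<in> const_algebra G \<Longrightarrow> P * Q \<in> const_algebra G"

definition op_subst :: "'a :: differential_field poly \<Rightarrow> 'a diff_op \<Rightarrow> 'a diff_op" where
  "op_subst p L = (\<Sum>i\<le>Polynomial.degree p. op_const (poly.coeff p i) * L ^ i)"

text \<open>\<open>A\<close> is the partner of \<open>L\<close>, of level \<open>s\<close>, with relation \<open>A\<^sup>2 + R(L) = 0\<close>.\<close>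
definition partner ::
  "nat \<Rightarrow> 'a :: differential_field diff_op \<Rightarrow> 'a diff_op \<Rightarrow> 'a poly \<Rightarrow> bool" where
  "partner s L A R \<longleftrightarrow>
     op_monic A \<and> op_order A = 2 * s + 1 \<and>
     A \<in> centralizer L - const_algebra {L} \<and>
     (\<forall>B \<in> centralizer L - const_algebra {L}. op_order A \<le> op_order B) \<and>
     centralizer L = const_algebra {L, A} \<and>
     R \<in> polys_over (constants UNIV) \<and> Polynomial.degree R = 2 * s + 1 \<and>
     A ^ 2 + op_subst R L = 0"


section \<open>The function field of the spectral curve\<close>

text \<open>Polynomials in \<open>\<lambda>\<close> and \<open>\<mu>\<close> are encoded as polynomials in \<open>\<mu>\<close> whose coefficients are
  polynomials in \<open>\<lambda>\<close>.\<close>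

definition polys2_over :: "'a :: zero set \<Rightarrow> 'a poly poly set" where
  "polys2_over S = {p. \<forall>i. poly.coeff p i \<in> polys_over S}"

definition spectral_poly :: "'a :: comm_ring_1 poly \<Rightarrow> 'a poly poly" where
  "spectral_poly R = [:R, 0, 1:]"

definition eval2 :: "('a :: zero \<Rightarrow> 'b :: comm_ring_1) \<Rightarrow> 'b \<Rightarrow> 'b \<Rightarrow> 'a poly poly \<Rightarrow> 'b" where
  "eval2 j lam mu p = poly (map_poly (\<lambda>c. poly (map_poly j c) lam) p) mu"

text \<open>The type of \<open>j\<close>'s values is a differential field into which \<open>K[\<lambda>,\<mu>]/(f)\<close>, with
  \<open>f = \<mu>\<^sup>2 + R(\<lambda>)\<close> and \<open>\<partial>\<lambda> = \<partial>\<mu> = 0\<close>, is embedded: \<open>j\<close> is a homomorphism of differential rings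
  on \<open>K\<close> (its values outside \<open>K\<close> are irrelevant; the coefficients of
  \<open>L\<close> and of its partner lie in \<open>K\<close>), and the evaluation at the images \<open>lam\<close> and
  \<open>mu\<close> of \<open>\<lambda>\<close> and \<open>\<mu>\<close> has kernel exactly the ideal \<open>(f)\<close> of \<open>K[\<lambda>,\<mu>]\<close>.\<close>
definition spectral_embedding ::
  "'a :: differential_field set \<Rightarrow> 'a poly \<Rightarrow> ('a \<Rightarrow> 'b :: differential_field) \<Rightarrow> 'b \<Rightarrow> 'b \<Rightarrow> bool" where
  "spectral_embedding K R j lam mu \<longleftrightarrow>
     j 1 = 1 \<and>
     (\<forall>x\<in>K. \<forall>y\<in>K. j (x + y) = j x + j y \<and> j (x * y) = j x * j y) \<and>
     (\<forall>x\<in>K. j (\<partial> x) = \<partial> (j x)) \<and>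
     \<partial> lam = 0 \<and> \<partial> mu = 0 \<and>
     (\<forall>p\<in>polys2_over K. eval2 j lam mu p = 0 \<longleftrightarrow> (\<exists>q\<in>polys2_over K. p = q * spectral_poly R))"

text \<open>Given such an embedding, this is the fraction field of \<open>F[\<lambda>,\<mu>]/(f)\<close> for every subfield
  \<open>F\<close> of \<open>K\<close> that contains the coefficients of \<open>f\<close>. Its derivation is the restriction of \<open>\<partial>\<close>.\<close>
definition curve_field ::
  "'a :: zero set \<Rightarrow> ('a \<Rightarrow> 'b :: Fields.field) \<Rightarrow> 'b \<Rightarrow> 'b \<Rightarrow> 'b set" where
  "curve_field F j lam mu =
     {eval2 j lam mu p / eval2 j lam mu q | p q.
        p \<in> polys2_over F \<and> q \<in> polys2_over F \<and> eval2 j lam mu q \<noteq> 0}"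


section \<open>Differential closure\<close>

definition differential_field_on :: "('a, 'm) ring_scheme \<Rightarrow> ('a \<Rightarrow> 'a) \<Rightarrow> bool" where
  "differential_field_on V d \<longleftrightarrow> field V \<and> d \<in> carrier V \<rightarrow> carrier V \<and>
     (\<forall>x\<in>carrier V. \<forall>y\<in>carrier V. d (x \<oplus>\<^bsub>V\<^esub> y) = d x \<oplus>\<^bsub>V\<^esub> d y \<and>
        d (x \<otimes>\<^bsub>V\<^esub> y) = (d x \<otimes>\<^bsub>V\<^esub> y) \<oplus>\<^bsub>V\<^esub> (x \<otimes>\<^bsub>V\<^esub> d y))"

text \<open>Differential polynomials in one indeterminate \<open>X\<close> are the polynomials in the letters
  \<open>X\<^sub>i = d\<^sup>i X\<close>, \<open>i \<in> \<nat>\<close>.\<close>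
abbreviation diff_polys :: "('a, 'm) ring_scheme \<Rightarrow> (nat multiset \<Rightarrow> 'a) set" where
  "diff_polys V \<equiv> ring.indexed_pset V UNIV (carrier V)"

definition diff_poly_eval ::
  "('a, 'm) ring_scheme \<Rightarrow> ('a \<Rightarrow> 'a) \<Rightarrow> (nat multiset \<Rightarrow> 'a) \<Rightarrow> 'a \<Rightarrow> 'a" where
  "diff_poly_eval V d f a =
     (\<Oplus>\<^bsub>V\<^esub>m\<in>{m. f m \<noteq> \<zero>\<^bsub>V\<^esub>}. f m \<otimes>\<^bsub>V\<^esub> (\<Otimes>\<^bsub>V\<^esub>i\<in>set_mset m. (d ^^ i) a [^]\<^bsub>V\<^esub> count m i))"

text \<open>Blum's axioms: if \<open>g \<noteq> 0\<close> has smaller order than \<open>f\<close>, then some \<open>a\<close> satisfies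
  \<open>f(a) = 0 \<noteq> g(a)\<close>. The condition on \<open>n\<close> says that the order of \<open>f\<close> is at least \<open>n\<close> and that of
  \<open>g\<close> less than \<open>n\<close>; elements of the field count as differential polynomials of order \<open>-1\<close>.\<close>
definition differentially_closed :: "('a, 'm) ring_scheme \<Rightarrow> ('a \<Rightarrow> 'a) \<Rightarrow> bool" where
  "differentially_closed V d \<longleftrightarrow>
     (\<forall>f\<in>diff_polys V. \<forall>g\<in>diff_polys V. \<forall>n.
        g \<noteq> (\<lambda>_. \<zero>\<^bsub>V\<^esub>) \<and> \<not> ring.index_free V f n \<and> (\<forall>i\<ge>n. ring.index_free V g i) \<longrightarrow>
        (\<exists>a\<in>carrier V. diff_poly_eval V d f a = \<zero>\<^bsub>V\<^esub> \<and> diff_poly_eval V d g a \<noteq> \<zero>\<^bsub>V\<^esub>))"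

text \<open>The whole type is a differential closure of its differential subfield \<open>k\<close>: it is
  differentially closed and embeds over \<open>k\<close> into every differentially closed extension \<open>(V, d)\<close>
  of \<open>k\<close>. It is enough to let \<open>V\<close> range over the structures with carrier in the same type: by
  Loewenheim-Skolem every differentially closed extension of the infinite field \<open>k\<close> contains one
  of the cardinality of \<open>k\<close>.\<close>
definition differential_closure_of :: "'b :: differential_field set \<Rightarrow> bool" where
  "differential_closure_of k \<longleftrightarrow> diff_subfield k \<and>
     differentially_closed (ring_of_type_algebra :: 'b ring) \<partial> \<and>
     (\<forall>(V :: 'b ring) d i.
        differential_field_on V d \<and> differentially_closed V d \<and>
        i \<in> ring_hom (ring_of_type_algebra\<lparr>carrier := k\<rparr>) V \<and> (\<forall>x\<in>k. i (\<partial> x) = d (i x)) \<longrightarrow>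
        (\<exists>h \<in> ring_hom ring_of_type_algebra V. (\<forall>x. h (\<partial> x) = d (h x)) \<and> (\<forall>x\<in>k. h x = i x)))"


section \<open>Spectral Picard-Vessiot fields\<close>

text \<open>\<open>k\<close> and \<open>c\<close> stand for \<open>K(\<Gamma>)\<close> and \<open>C(\<Gamma>)\<close>, and \<open>P\<close> for the operator of the equation.\<close>
definition spectral_picard_vessiot ::
  "'b :: differential_field set \<Rightarrow> 'b set \<Rightarrow> 'b diff_op \<Rightarrow> 'b set \<Rightarrow> bool" where
  "spectral_picard_vessiot k c P E \<longleftrightarrow> diff_subfield E \<and> k \<subseteq> E \<and>
     (\<exists>\<Psi>1 \<Psi>2. fundamental_set P {\<Psi>1, \<Psi>2} \<and> E = diff_field_gen (k \<union> {\<Psi>1, \<Psi>2})) \<and>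
     constants E = c \<and> constants k = c"

end

theory Submission
  imports Defs
begin

text \<open>
  Let \<open>k = K(\<Gamma>)\<close> and \<open>U = j u\<close>. The operator \<open>L - \<lambda>\<close> is a left multiple of \<open>\<partial> - \<phi>\<close>, which kills \<open>\<Psi>\<close>. So \<open>\<Psi>\<close> solves
  \<open>\<partial>\<^sup>2 y = (U - \<lambda>) y\<close>, that is, \<open>\<phi>\<close> satisfies the Riccati equation \<open>\<partial> \<phi> + \<phi>\<^sup>2 = U - \<lambda>\<close>. This equation, to be
  studied inside \<open>k\<close>, carries the proof.

  Write \<open>\<phi> = p + r \<mu>\<close> with \<open>p, r \<in> K(\<lambda>)\<close>. Since \<open>\<mu>\<^sup>2 = - R(\<lambda>)\<close>, the equation splits into
  \<open>\<partial> r = - 2 p r\<close> and \<open>\<partial> p + p\<^sup>2 - r\<^sup>2 R(\<lambda>) = U - \<lambda>\<close>. Comparing degrees in \<open>\<lambda>\<close>, which \<open>\<partial>\<close> does not raise,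
  shows \<open>r \<noteq> 0\<close> (\<open>riccati_not_rational\<close>). Hence the conjugate \<open>\<phi>' = p - r \<mu>\<close> is a second solution of the
  Riccati equation, and \<open>1 / (r \<Psi>)\<close> is a second solution of the linear equation that lies in \<open>k(\<Psi>)\<close> and
  is independent of \<open>\<Psi>\<close> (\<open>conjugate_solution\<close>). So \<open>k(\<Psi>)\<close> is generated by a fundamental set.

  For the constants, let the only place of the curve at infinity decide. There \<open>\<phi>\<close> has a pole, because
  \<open>\<phi>\<^sup>2\<close> must balance \<open>\<lambda>\<close>, whereas \<open>\<partial>\<close> acts on the coefficients of expansions at this place and so raises
  no pole orders. Hence \<open>\<partial> g = n \<phi> g\<close> with \<open>g \<in> k\<close> and an integer \<open>n \<noteq> 0\<close> forces \<open>g = 0\<close>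
  (\<open>riccati_no_exponentials\<close>). The proof phrases this with degrees in \<open>\<lambda>\<close> of the coordinates with respect
  to \<open>1, \<mu>\<close> instead of with expansions. By a descent on degrees, an exponential \<open>\<Psi>\<close> of such a \<open>\<phi>\<close> is
  transcendental over \<open>k\<close>, and \<open>k(\<Psi>)\<close> has no constants outside \<open>k\<close> (\<open>constants_adjoin_exponential\<close>).
  The same descent gives the constants of \<open>K(\<lambda>)\<close>; with the coordinates above, those of \<open>k\<close> form \<open>C(\<Gamma>)\<close>
  (\<open>constants_F_curve\<close>).
\<close>

section \<open>Subrings, subfields and simple extensions\<close>

definition is_subring :: "'a :: Fields.field set \<Rightarrow> bool" where
  "is_subring S \<longleftrightarrow> 0 \<in> S \<and> 1 \<in> S \<and> (\<forall>x\<in>S. \<forall>y\<in>S. x + y \<in> S \<and> x * y \<in> S) \<and> (\<forall>x\<in>S. - x \<in> S)"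

definition is_subfield :: "'a :: Fields.field set \<Rightarrow> bool" where
  "is_subfield S \<longleftrightarrow> is_subring S \<and> (\<forall>x\<in>S. inverse x \<in> S)"

lemma subring_closed:
  assumes "is_subring S"
  shows "0 \<in> S" "1 \<in> S" "x \<in> S \<Longrightarrow> y \<in> S \<Longrightarrow> x + y \<in> S" "x \<in> S \<Longrightarrow> y \<in> S \<Longrightarrow> x * y \<in> S"
    "x \<in> S \<Longrightarrow> - x \<in> S" "x \<in> S \<Longrightarrow> y \<in> S \<Longrightarrow> x - y \<in> S"
  using assms unfolding is_subring_def by (auto simp del: add_uminus_conv_diff simp: diff_conv_add_uminus)

lemma subring_sum: "is_subring S \<Longrightarrow> (\<And>i. i \<in> A \<Longrightarrow> f i \<in> S) \<Longrightarrow> sum f A \<in> S"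
  by (induction A rule: infinite_finite_induct) (auto simp: subring_closed)

lemma subring_of_nat: "is_subring S \<Longrightarrow> of_nat n \<in> S"
  by (induction n) (auto simp: subring_closed)

lemma subring_power: "is_subring S \<Longrightarrow> x \<in> S \<Longrightarrow> x ^ n \<in> S"
  by (induction n) (auto simp: subring_closed)

lemma subring_poly: "is_subring S \<Longrightarrow> p \<in> polys_over S \<Longrightarrow> t \<in> S \<Longrightarrow> poly p t \<in> S"
  unfolding poly_altdef
  by (auto intro!: subring_sum subring_closed(4) subring_power simp: polys_over_def)

lemma subfield_closed:
  assumes "is_subfield S"
  shows "is_subring S" "x \<in> S \<Longrightarrow> inverse x \<in> S" "x \<in> S \<Longrightarrow> y \<in> S \<Longrightarrow> x / y \<in> S"
  using assms subring_closed[of S] by (auto simp: is_subfield_def divide_inverse)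

lemma diff_subfield_iff: "diff_subfield S \<longleftrightarrow> is_subfield S \<and> (\<forall>x\<in>S. \<partial> x \<in> S)"
  by (auto simp: diff_subfield_def is_subfield_def is_subring_def)

lemma polys_over_closed:
  assumes "is_subring S"
  shows "0 \<in> polys_over S" "1 \<in> polys_over S"
    "p \<in> polys_over S \<Longrightarrow> q \<in> polys_over S \<Longrightarrow> p + q \<in> polys_over S"
    "p \<in> polys_over S \<Longrightarrow> - p \<in> polys_over S"
    "p \<in> polys_over S \<Longrightarrow> q \<in> polys_over S \<Longrightarrow> p - q \<in> polys_over S"
    "p \<in> polys_over S \<Longrightarrow> q \<in> polys_over S \<Longrightarrow> p * q \<in> polys_over S"
    "a \<in> S \<Longrightarrow> p \<in> polys_over S \<Longrightarrow> Polynomial.smult a p \<in> polys_over S"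
    "a \<in> S \<Longrightarrow> p \<in> polys_over S \<Longrightarrow> pCons a p \<in> polys_over S"
    "p \<in> polys_over S \<Longrightarrow> pderiv p \<in> polys_over S"
  using subring_closed[OF assms]
  by (auto simp: polys_over_def coeff_pCons coeff_pderiv coeff_mult intro!: subring_sum[OF assms]
      simp del: of_nat_Suc split: nat.split)
     (metis subring_of_nat[OF assms])+

definition poly_values :: "'a :: Fields.field set \<Rightarrow> 'a \<Rightarrow> 'a set" where
  "poly_values S t = (\<lambda>p. poly p t) ` polys_over S"

definition fractions :: "'a :: Fields.field set \<Rightarrow> 'a set" where
  "fractions S = {a / b | a b. a \<in> S \<and> b \<in> S \<and> b \<noteq> 0}"

definition adjoin :: "'a :: Fields.field set \<Rightarrow> 'a \<Rightarrow> 'a set" where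
  "adjoin F t = fractions (poly_values F t)"

lemma subring_poly_values:
  assumes "is_subring S"
  shows "is_subring (poly_values S t)"
proof -
  note c = polys_over_closed[OF assms]
  show ?thesis
    unfolding is_subring_def poly_values_def
    by (auto simp flip: poly_add poly_mult poly_minus intro!: imageI c
        intro: image_eqI[OF _ c(1)] image_eqI[OF _ c(2)])
qed

lemma subset_poly_values:
  assumes "is_subring S"
  shows "S \<subseteq> poly_values S t" "t \<in> poly_values S t"
proof -
  note c = polys_over_closed[OF assms] subring_closed[OF assms]
  show "S \<subseteq> poly_values S t"
  proof
    fix x assume "x \<in> S"
    then show "x \<in> poly_values S t"
      unfolding poly_values_def by (intro image_eqI[of _ _ "[:x:]"]) (auto intro!: c)
  qed
  show "t \<in> poly_values S t"
    unfolding poly_values_def by (intro image_eqI[of _ _ "[:0, 1:]"]) (auto intro!: c)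
qed

lemma subset_fractions: "is_subring S \<Longrightarrow> S \<subseteq> fractions S"
  unfolding fractions_def by (force intro: exI[of _ 1] dest: subring_closed)

lemma subfield_fractions:
  assumes "is_subring S"
  shows "is_subfield (fractions S)"
proof -
  note c = subring_closed[OF assms]
  have add: "a / b + a' / b' \<in> fractions S" and mult: "a / b * (a' / b') \<in> fractions S"
    if "a \<in> S" "b \<in> S" "b \<noteq> 0" "a' \<in> S" "b' \<in> S" "b' \<noteq> 0" for a b a' b'
  proof -
    have "a / b + a' / b' = (a * b' + a' * b) / (b * b')"
      using that by (simp add: add_frac_eq)
    then show "a / b + a' / b' \<in> fractions S"
      unfolding fractions_def using that
      by (intro CollectI exI[of _ "a * b' + a' * b"] exI[of _ "b * b'"]) (auto intro!: c)
    show "a / b * (a' / b') \<in> fractions S"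
      unfolding fractions_def using that
      by (intro CollectI exI[of _ "a * a'"] exI[of _ "b * b'"]) (auto intro!: c)
  qed
  have minus: "- (a / b) \<in> fractions S" if "a \<in> S" "b \<in> S" "b \<noteq> 0" for a b
    unfolding fractions_def using that
    by (intro CollectI exI[of _ "- a"] exI[of _ b]) (auto intro!: c)
  have zero: "0 \<in> fractions S" and one: "1 \<in> fractions S"
    using subset_fractions[OF assms] c by auto
  have inv: "inverse (a / b) \<in> fractions S" if "a \<in> S" "b \<in> S" "b \<noteq> 0" for a b
  proof (cases "a = 0")
    case False
    then show ?thesis
      unfolding fractions_def using that by (intro CollectI exI[of _ b] exI[of _ a]) auto
  qed (use zero in simp)
  have ex: "\<exists>a b. x = a / b \<and> a \<in> S \<and> b \<in> S \<and> b \<noteq> 0" if "x \<in> fractions S" for x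
    using that by (auto simp: fractions_def)
  show ?thesis
    unfolding is_subfield_def is_subring_def
    using zero one add mult minus inv by (auto dest!: ex)
qed

lemma fractions_subset: "is_subfield T \<Longrightarrow> S \<subseteq> T \<Longrightarrow> fractions S \<subseteq> T"
  unfolding fractions_def by (auto dest: subfield_closed(3))

lemma subfield_adjoin: "is_subring F \<Longrightarrow> is_subfield (adjoin F t)"
  by (simp add: adjoin_def subfield_fractions subring_poly_values)

lemma subset_adjoin:
  assumes "is_subring F"
  shows "F \<subseteq> adjoin F t" "t \<in> adjoin F t"
  using subset_poly_values[OF assms, of t] subset_fractions[OF subring_poly_values[OF assms], of t]
  by (auto simp: adjoin_def)

lemma adjoin_subset:
  assumes "is_subfield T" "F \<subseteq> T" "t \<in> T"
  shows "adjoin F t \<subseteq> T"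
  unfolding adjoin_def
proof (rule fractions_subset[OF assms(1)])
  show "poly_values F t \<subseteq> T"
  proof
    fix x assume "x \<in> poly_values F t"
    then obtain p where p: "p \<in> polys_over F" "x = poly p t"
      by (auto simp: poly_values_def)
    then have "p \<in> polys_over T" using assms(2) by (auto simp: polys_over_def)
    then show "x \<in> T"
      using subring_poly[OF subfield_closed(1)[OF assms(1)]] assms(3) p(2) by blast
  qed
qed

lemma adjoin_mono:
  assumes "is_subring G" "F \<subseteq> G"
  shows "adjoin F t \<subseteq> adjoin G t"
  by (rule adjoin_subset[OF subfield_adjoin]) (use assms subset_adjoin[OF assms(1)] in auto)

lemma adjoinE:
  assumes "x \<in> adjoin F t"
  obtains p q where "p \<in> polys_over F" "q \<in> polys_over F" "poly q t \<noteq> 0" "x = poly p t / poly q t"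
  using assms by (auto simp: adjoin_def fractions_def poly_values_def)

lemma adjoinI:
  assumes "p \<in> polys_over F" "q \<in> polys_over F" "poly q t \<noteq> 0"
  shows "poly p t / poly q t \<in> adjoin F t"
  using assms by (auto simp: adjoin_def fractions_def poly_values_def)

text \<open>Conjugation \<open>t \<mapsto> - t\<close> rationalizes denominators, so \<open>F(t) = F + F t\<close>. This gives
  coordinates on the function field of the curve.\<close>
lemma adjoin_sqrtE:
  assumes F: "is_subfield F" and t: "t ^ 2 \<in> F" "t \<notin> F" and x: "x \<in> adjoin F t"
  obtains a b where "a \<in> F" "b \<in> F" "x = a + b * t"
proof -
  define T where "T = {a + b * t | a b. a \<in> F \<and> b \<in> F}"
  note c = subfield_closed[OF F] subring_closed[OF subfield_closed(1)[OF F]]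
  have I: "a + b * t \<in> T" if "a \<in> F" "b \<in> F" for a b
    using that by (auto simp: T_def)
  have FT: "F \<subseteq> T"
    using I[of _ 0] c by auto
  have tT: "t \<in> T"
    using I[of 0 1] c by auto
  have mult: "(a + b * t) * (a' + b' * t) \<in> T" if "a \<in> F" "b \<in> F" "a' \<in> F" "b' \<in> F" for a b a' b'
  proof -
    have "(a + b * t) * (a' + b' * t) = (a * a' + b * b' * t ^ 2) + (a * b' + b * a') * t"
      by (simp add: algebra_simps power2_eq_square)
    then show ?thesis using that t by (auto intro!: I c)
  qed
  have inv: "inverse (a + b * t) \<in> T" if "a \<in> F" "b \<in> F" for a b
  proof (cases "a + b * t = 0")
    case True
    then show ?thesis using FT c by auto
  next
    case False
    have "a - b * t \<noteq> 0"
    proof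
      assume "a - b * t = 0"
      then have "b \<noteq> 0 \<Longrightarrow> t = a / b" by (simp add: field_simps)
      then have "b = 0" using t that c by metis
      with False \<open>a - b * t = 0\<close> show False by simp
    qed
    moreover have "a ^ 2 - b ^ 2 * t ^ 2 = (a + b * t) * (a - b * t)"
      by (simp add: algebra_simps power2_eq_square)
    ultimately have "inverse (a + b * t) = (a - b * t) / (a ^ 2 - b ^ 2 * t ^ 2)"
      by (simp add: divide_inverse)
    also have "\<dots> = a / (a ^ 2 - b ^ 2 * t ^ 2) + (- b / (a ^ 2 - b ^ 2 * t ^ 2)) * t"
      by (simp add: diff_divide_distrib)
    also have "\<dots> \<in> T"
      using that t(1) by (intro I c) (simp_all add: power2_eq_square c)
    finally show ?thesis .
  qed
  have add: "(a + b * t) + (a' + b' * t) \<in> T" if "a \<in> F" "b \<in> F" "a' \<in> F" "b' \<in> F" for a b a' b'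
  proof -
    have eq: "(a + b * t) + (a' + b' * t) = (a + a') + (b + b') * t"
      by (simp add: algebra_simps)
    show ?thesis unfolding eq using that by (intro I c)
  qed
  have minus: "- (a + b * t) \<in> T" if "a \<in> F" "b \<in> F" for a b
    using I[of "- a" "- b"] that c by (simp add: algebra_simps)
  have ex: "\<exists>a b. y = a + b * t \<and> a \<in> F \<and> b \<in> F" if "y \<in> T" for y
    using that by (auto simp: T_def)
  have "y + z \<in> T" "y * z \<in> T" if "y \<in> T" "z \<in> T" for y z
    using ex[OF that(1)] ex[OF that(2)] add mult by blast+
  moreover have "- y \<in> T" "inverse y \<in> T" if "y \<in> T" for y
    using ex[OF that] minus inv by blast+
  moreover have "0 \<in> T" "1 \<in> T"
    using FT c by blast+
  ultimately have "is_subfield T"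
    by (simp add: is_subfield_def is_subring_def)
  from adjoin_subset[OF this FT tT] x have "x \<in> T" ..
  from ex[OF this] that show thesis by blast
qed

section \<open>Derivations and simple extensions\<close>

lemma der_minus: "\<partial> (- x :: 'a :: differential_field) = - \<partial> x"
  using der_add[of x "- x"] by (simp add: add_eq_0_iff)

lemma der_diff: "\<partial> (x - y :: 'a :: differential_field) = \<partial> x - \<partial> y"
  using der_add[of x "- y"] by (simp add: der_minus)

lemma der_inverse:
  assumes "(x :: 'a :: differential_field) \<noteq> 0"
  shows "\<partial> (inverse x) = - \<partial> x / x ^ 2"
proof -
  have "\<partial> x * inverse x + x * \<partial> (inverse x) = 0"
    using der_mult[of x "inverse x"] assms by simp
  then show ?thesis
    using assms by (simp add: field_simps power2_eq_square add_eq_0_iff)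
qed

lemma der_divide:
  assumes "(y :: 'a :: differential_field) \<noteq> 0"
  shows "\<partial> (x / y) = (\<partial> x * y - x * \<partial> y) / y ^ 2"
proof -
  have "\<partial> (x / y) = \<partial> x / y + x * (- \<partial> y / y ^ 2)"
    unfolding divide_inverse[of x] der_mult der_inverse[OF assms] by (simp add: divide_inverse)
  also have "\<partial> x / y = \<partial> x * y / y ^ 2"
    using assms by (simp add: power2_eq_square)
  finally show ?thesis by (simp add: diff_divide_distrib)
qed

lemma der_poly: "\<partial> (poly p t) = poly (map_poly \<partial> p) t + poly (pderiv p) t * \<partial> t"
  for t :: "'a :: differential_field"
  by (induction p) (auto simp: map_poly_pCons pderiv_pCons der_add der_mult algebra_simps)

lemma subfield_constants: "is_subfield F \<Longrightarrow> is_subfield (constants F)"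
  for F :: "'a :: differential_field set"
proof -
  assume F: "is_subfield F"
  have "\<partial> (inverse x) = 0" if "\<partial> x = 0" for x :: 'a
    using that der_inverse[of x] by (cases "x = 0") auto
  then show ?thesis
    using F by (simp add: is_subfield_def is_subring_def constants_def der_add der_mult der_minus)
qed

lemma map_der_polys_over: "diff_subfield F \<Longrightarrow> p \<in> polys_over F \<Longrightarrow> map_poly \<partial> p \<in> polys_over F"
  by (auto simp: polys_over_def coeff_map_poly diff_subfield_iff)

lemma diff_subfield_adjoin:
  assumes F: "diff_subfield F" and t: "\<partial> t \<in> adjoin F t"
  shows "diff_subfield (adjoin F t)"
proof -
  have r: "is_subring F" using F by (auto simp: diff_subfield_iff is_subfield_def)
  note a = subfield_adjoin[OF r, of t]
  note c = subfield_closed[OF a] subring_closed[OF subfield_closed(1)[OF a]]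
  have p: "poly p t \<in> adjoin F t" if "p \<in> polys_over F" for p
    using adjoinI[OF that, of 1 t] polys_over_closed(2)[OF r] by simp
  have d: "\<partial> (poly p t) \<in> adjoin F t" if "p \<in> polys_over F" for p
    unfolding der_poly using that t map_der_polys_over[OF F that] polys_over_closed(9)[OF r that]
    by (intro c p)
  have "\<partial> x \<in> adjoin F t" if "x \<in> adjoin F t" for x
    using that
    by (rule adjoinE) (auto simp: der_divide power2_eq_square intro!: c p d)
  with a show ?thesis by (auto simp: diff_subfield_iff)
qed

lemma diff_subfield_gen: "diff_subfield (diff_field_gen S)"
  unfolding diff_field_gen_def
  by (rule hull_in) (unfold diff_subfield_def, blast)

lemma diff_field_gen_minimal: "diff_subfield T \<Longrightarrow> S \<subseteq> T \<Longrightarrow> diff_field_gen S \<subseteq> T"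
  unfolding diff_field_gen_def by (rule hull_minimal)

lemma subset_diff_field_gen: "S \<subseteq> diff_field_gen S"
  unfolding diff_field_gen_def by (rule hull_subset)

text \<open>As soon as \<open>\<partial> t\<close> lies in \<open>F(t)\<close>, the field \<open>F(t)\<close> is closed under \<open>\<partial>\<close> already, and no higher
  derivatives of \<open>t\<close> have to be adjoined.\<close>
lemma diff_field_gen_insert:
  assumes F: "diff_subfield F" and t: "\<partial> t \<in> adjoin F t"
  shows "diff_field_gen (F \<union> {t}) = adjoin F t"
proof
  have r: "is_subring F" using F by (auto simp: diff_subfield_iff is_subfield_def)
  show "diff_field_gen (F \<union> {t}) \<subseteq> adjoin F t"
    using subset_adjoin[OF r] by (intro diff_field_gen_minimal diff_subfield_adjoin F t) auto
  show "adjoin F t \<subseteq> diff_field_gen (F \<union> {t})"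
    using diff_subfield_gen subset_diff_field_gen[of "F \<union> {t}"]
    by (intro adjoin_subset) (auto simp: diff_subfield_iff)
qed

section \<open>Constants of exponential extensions\<close>

definition transcendental_over :: "'a :: Fields.field set \<Rightarrow> 'a \<Rightarrow> bool" where
  "transcendental_over F t \<longleftrightarrow> (\<forall>p\<in>polys_over F. poly p t = 0 \<longrightarrow> p = 0)"

text \<open>Suppose \<open>\<partial> t = \<phi> t\<close>. The derivation of \<open>F[X]\<close> that extends \<open>\<partial>\<close> by \<open>X \<mapsto> \<phi> X\<close> is compatible with
  evaluation at \<open>t\<close>; subtracting \<open>m \<phi>\<close> makes it kill the leading term of a monic polynomial of
  degree \<open>m\<close>. Up to the factor \<open>t\<^sup>m\<close> this is the derivative of \<open>p(t) / t\<^sup>m\<close>.\<close>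
definition twisted_der :: "'a :: differential_field \<Rightarrow> nat \<Rightarrow> 'a poly \<Rightarrow> 'a poly" where
  "twisted_der \<phi> m p = map_poly \<partial> p + [:0, \<phi>:] * pderiv p - Polynomial.smult (of_nat m * \<phi>) p"

lemma coeff_twisted_der:
  "poly.coeff (twisted_der \<phi> m p) i = \<partial> (poly.coeff p i) - (of_nat m - of_nat i) * \<phi> * poly.coeff p i"
  by (cases i) (auto simp: twisted_der_def coeff_map_poly coeff_pderiv algebra_simps)

lemma poly_twisted_der:
  assumes "\<partial> t = \<phi> * t"
  shows "poly (twisted_der \<phi> m p) t = \<partial> (poly p t) - of_nat m * \<phi> * poly p t"
  by (simp add: twisted_der_def der_poly assms algebra_simps)

lemma twisted_der_polys_over:
  assumes F: "diff_subfield F" and "\<phi> \<in> F" "p \<in> polys_over F"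
  shows "twisted_der \<phi> m p \<in> polys_over F"
proof -
  have r: "is_subring F" using F by (auto simp: diff_subfield_iff is_subfield_def)
  show ?thesis
    unfolding twisted_der_def using assms
    by (intro polys_over_closed[OF r] map_der_polys_over subring_closed[OF r] subring_of_nat[OF r])
qed

lemma degree_twisted_der_less:
  assumes "Polynomial.lead_coeff q = 1" "twisted_der \<phi> (Polynomial.degree q) q \<noteq> 0"
  shows "Polynomial.degree (twisted_der \<phi> (Polynomial.degree q) q) < Polynomial.degree q"
proof -
  have "poly.coeff (twisted_der \<phi> (Polynomial.degree q) q) i = 0" if "i \<ge> Polynomial.degree q" for i
    using that assms(1) by (cases "i = Polynomial.degree q") (auto simp: coeff_twisted_der coeff_eq_0)
  then show ?thesis
    using assms(2) leading_coeff_0_iff linorder_not_less by blast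
qed

text \<open>Scaling by the inverse of the leading coefficient turns a nonzero polynomial of least degree
  with a property into a monic one.\<close>
lemma normalized_minimal_poly:
  assumes F: "is_subfield F"
    and ex: "q0 \<in> polys_over F" "q0 \<noteq> 0" "P q0"
    and scale: "\<And>a q. a \<in> F \<Longrightarrow> a \<noteq> 0 \<Longrightarrow> P q \<Longrightarrow> P (Polynomial.smult a q)"
  obtains q where "q \<in> polys_over F" "Polynomial.lead_coeff q = 1" "P q"
    "\<And>q'. q' \<in> polys_over F \<Longrightarrow> q' \<noteq> 0 \<Longrightarrow> P q' \<Longrightarrow> Polynomial.degree q \<le> Polynomial.degree q'"
proof -
  obtain q where q: "q \<in> polys_over F \<and> q \<noteq> 0 \<and> P q"
    and min: "\<And>q'. q' \<in> polys_over F \<and> q' \<noteq> 0 \<and> P q' \<Longrightarrow> Polynomial.degree q \<le> Polynomial.degree q'"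
    using ex_has_least_nat[of "\<lambda>q. q \<in> polys_over F \<and> q \<noteq> 0 \<and> P q" q0 Polynomial.degree] ex by blast
  define a where "a = inverse (Polynomial.lead_coeff q)"
  have a: "a \<in> F" "a \<noteq> 0"
    using q subfield_closed[OF F] by (auto simp: a_def polys_over_def)
  show thesis
  proof (rule that[of "Polynomial.smult a q"])
    show "Polynomial.smult a q \<in> polys_over F"
      using a q polys_over_closed(7)[OF subfield_closed(1)[OF F]] by blast
    show "Polynomial.lead_coeff (Polynomial.smult a q) = 1"
      using q by (simp add: a_def)
  qed (use a q scale min in auto)
qed

text \<open>Among the denominators \<open>q\<close> of \<open>x\<close> take a monic one of least degree \<open>m\<close>, with numerator \<open>p\<close>. Because
  \<open>x\<close> is constant, applying the twisted derivation to \<open>p(t) = x q(t)\<close> gives another fraction for \<open>x\<close>,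
  whose denominator has degree less than \<open>m\<close>. Hence that denominator vanishes, and with it the
  numerator.\<close>
lemma constant_of_exponential_extension:
  assumes F: "diff_subfield F" and tr: "transcendental_over F t"
    and \<phi>: "\<phi> \<in> F" "\<partial> t = \<phi> * t" and x: "x \<in> adjoin F t" "\<partial> x = 0"
  obtains p q m where "p \<in> polys_over F" "q \<in> polys_over F" "q \<noteq> 0" "x = poly p t / poly q t"
    "twisted_der \<phi> m p = 0" "twisted_der \<phi> m q = 0"
proof -
  have f: "is_subfield F" and r: "is_subring F" using F by (auto simp: diff_subfield_iff is_subfield_def)
  let ?P = "\<lambda>q. \<exists>p\<in>polys_over F. poly p t = x * poly q t"
  obtain p0 q0 where q0: "p0 \<in> polys_over F" "q0 \<in> polys_over F" "poly q0 t \<noteq> 0" "x = poly p0 t / poly q0 t"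
    using x(1) by (rule adjoinE)
  have Pq0: "q0 \<noteq> 0" "?P q0" using q0 by auto
  have scale: "?P (Polynomial.smult a q)" if "a \<in> F" "a \<noteq> 0" "?P q" for a q
    using that polys_over_closed(7)[OF r] by (metis mult.left_commute poly_smult)
  obtain q where q: "q \<in> polys_over F" "Polynomial.lead_coeff q = 1" "?P q"
    and min: "\<And>q'. q' \<in> polys_over F \<Longrightarrow> q' \<noteq> 0 \<Longrightarrow> ?P q' \<Longrightarrow> Polynomial.degree q \<le> Polynomial.degree q'"
    by (rule normalized_minimal_poly[where P = ?P, OF f q0(2) Pq0 scale]) (assumption | rule that)+
  obtain p where p: "p \<in> polys_over F" "poly p t = x * poly q t"
    using q(3) by blast
  define m where "m = Polynomial.degree q"
  have tp: "twisted_der \<phi> m p \<in> polys_over F" and tq: "twisted_der \<phi> m q \<in> polys_over F"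
    using twisted_der_polys_over[OF F \<phi>(1)] p q by auto
  have eq: "poly (twisted_der \<phi> m p) t = x * poly (twisted_der \<phi> m q) t"
    unfolding poly_twisted_der[OF \<phi>(2)] p(2) by (simp add: der_mult x(2) algebra_simps)
  have q0': "twisted_der \<phi> m q = 0"
    using min[OF tq] eq tp degree_twisted_der_less[of q \<phi>] q(2) unfolding m_def
    by (metis linorder_not_less)
  moreover have "twisted_der \<phi> m p = 0"
    using eq tp tr unfolding q0' by (auto simp: transcendental_over_def)
  moreover have "q \<noteq> 0" using q(2) by auto
  moreover from this have "poly q t \<noteq> 0" using tr q(1) by (auto simp: transcendental_over_def)
  then have "x = poly p t / poly q t" using p(2) by simp
  ultimately show thesis using that p(1) q(1) by blast
qed

text \<open>For \<open>\<phi> = 0\<close> the twisted derivation acts on the coefficients alone.\<close>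
lemma constants_adjoin_constant:
  assumes F: "diff_subfield F" and tr: "transcendental_over F t" and t: "\<partial> t = 0"
    and x: "x \<in> adjoin F t" "\<partial> x = 0"
  shows "x \<in> adjoin (constants F) t"
proof -
  have r: "is_subring F" using F by (auto simp: diff_subfield_iff is_subfield_def)
  obtain p q m where pq: "p \<in> polys_over F" "q \<in> polys_over F" "q \<noteq> 0" "x = poly p t / poly q t"
    and tw: "twisted_der 0 m p = 0" "twisted_der 0 m q = 0"
    using constant_of_exponential_extension[OF F tr subring_closed(1)[OF r] _ x] t by auto
  have "p' \<in> polys_over (constants F)" if "p' \<in> polys_over F" "twisted_der 0 m p' = 0" for p'
    using that coeff_twisted_der[of 0 m p'] by (auto simp: polys_over_def constants_def)
  moreover have "poly q t \<noteq> 0" using tr pq by (auto simp: transcendental_over_def)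
  ultimately show ?thesis using pq tw adjoinI by metis
qed

text \<open>For \<open>\<partial> t = \<phi> t\<close> the condition says that no power \<open>t\<^sup>n\<close>, \<open>n \<noteq> 0\<close>, is a constant multiple of a nonzero
  element of \<open>F\<close>: the quotient \<open>g / t\<^sup>n\<close> is a constant exactly if \<open>\<partial> g = n \<phi> g\<close>. It is the criterion for \<open>t\<close> to be
  transcendental without new constants.\<close>
definition no_exponentials :: "'a :: differential_field set \<Rightarrow> 'a \<Rightarrow> bool" where
  "no_exponentials F \<phi> \<longleftrightarrow> (\<forall>g\<in>F. \<forall>n :: int. n \<noteq> 0 \<longrightarrow> \<partial> g = of_int n * \<phi> * g \<longrightarrow> g = 0)"

text \<open>The \<open>i\<close>-th coefficient satisfies \<open>\<partial> g = (m - i) \<phi> g\<close>, which only \<open>i = m\<close> allows for \<open>g \<noteq> 0\<close>.\<close>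
lemma twisted_der_eq_0_imp_monom:
  assumes no_exp: "no_exponentials F \<phi>"
    and p: "p \<in> polys_over F" "twisted_der \<phi> m p = 0"
  shows "p = Polynomial.monom (poly.coeff p m) m"
proof (rule poly_eqI)
  fix i
  have "poly.coeff p i = 0" if "i \<noteq> m"
  proof -
    have "\<partial> (poly.coeff p i) = of_int (int m - int i) * \<phi> * poly.coeff p i"
      using coeff_twisted_der[of \<phi> m p i] p(2) by simp
    moreover have "poly.coeff p i \<in> F" "int m - int i \<noteq> 0"
      using p(1) that by (auto simp: polys_over_def)
    ultimately show ?thesis
      using no_exp unfolding no_exponentials_def by blast
  qed
  then show "poly.coeff p i = poly.coeff (Polynomial.monom (poly.coeff p m) m) i"
    by auto
qed

text \<open>The twisted derivative of a minimal polynomial of \<open>t\<close> vanishes at \<open>t\<close> and has smaller degree, so it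
  is zero. As exponentials are excluded, the minimal polynomial is then a power of \<open>X\<close>, contrary to \<open>t \<noteq> 0\<close>.\<close>
lemma exponential_transcendental:
  assumes F: "diff_subfield F" and \<phi>: "\<phi> \<in> F" "\<partial> t = \<phi> * t" and "t \<noteq> 0"
    and no_exp: "no_exponentials F \<phi>"
  shows "transcendental_over F t"
proof (rule ccontr)
  assume "\<not> transcendental_over F t"
  then obtain q0 where q0: "q0 \<in> polys_over F" "q0 \<noteq> 0" "poly q0 t = 0"
    by (auto simp: transcendental_over_def)
  have f: "is_subfield F" using F by (auto simp: diff_subfield_iff)
  obtain q where q: "q \<in> polys_over F" "Polynomial.lead_coeff q = 1" "poly q t = 0"
    and min: "\<And>q'. q' \<in> polys_over F \<Longrightarrow> q' \<noteq> 0 \<Longrightarrow> poly q' t = 0 \<Longrightarrow> Polynomial.degree q \<le> Polynomial.degree q'"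
    using normalized_minimal_poly[OF f q0(1), of "\<lambda>q. poly q t = 0"] q0 by auto
  define m where "m = Polynomial.degree q"
  have "twisted_der \<phi> m q = 0"
    using min[OF twisted_der_polys_over[OF F \<phi>(1) q(1)]] q(2,3) degree_twisted_der_less[of q \<phi>]
      poly_twisted_der[OF \<phi>(2), of m q] unfolding m_def
    by (metis der_0 diff_self linorder_not_less mult_zero_right)
  then have "q = Polynomial.monom 1 m"
    using twisted_der_eq_0_imp_monom[OF no_exp q(1)] q(2) unfolding m_def by metis
  then show False using q(3) \<open>t \<noteq> 0\<close> by (simp add: poly_monom)
qed

text \<open>A constant \<open>p(t) / q(t)\<close> has \<open>p\<close> and \<open>q\<close> proportional to the same power of \<open>X\<close>, so it lies in \<open>F\<close>.\<close>
lemma constants_adjoin_exponential: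
  assumes F: "diff_subfield F" and \<phi>: "\<phi> \<in> F" "\<partial> t = \<phi> * t" and "t \<noteq> 0"
    and no_exp: "no_exponentials F \<phi>"
  shows "constants (adjoin F t) = constants F"
proof
  have f: "is_subfield F" using F by (auto simp: diff_subfield_iff)
  show "constants F \<subseteq> constants (adjoin F t)"
    using subset_adjoin(1)[OF subfield_closed(1)[OF f]] by (auto simp: constants_def)
  show "constants (adjoin F t) \<subseteq> constants F"
  proof
    fix x assume "x \<in> constants (adjoin F t)"
    then have x: "x \<in> adjoin F t" "\<partial> x = 0" by (auto simp: constants_def)
    obtain p q m where pq: "p \<in> polys_over F" "q \<in> polys_over F" "q \<noteq> 0" "x = poly p t / poly q t"
      and tw: "twisted_der \<phi> m p = 0" "twisted_der \<phi> m q = 0"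
      using constant_of_exponential_extension[OF F exponential_transcendental[OF assms] \<phi> x] by metis
    have "p = Polynomial.monom (poly.coeff p m) m" "q = Polynomial.monom (poly.coeff q m) m"
      using twisted_der_eq_0_imp_monom[OF no_exp] pq tw by auto
    then have "poly p t = poly.coeff p m * t ^ m" "poly q t = poly.coeff q m * t ^ m"
      by (metis poly_monom)+
    then have "x = poly.coeff p m / poly.coeff q m"
      using pq(4) \<open>t \<noteq> 0\<close> by simp
    then show "x \<in> constants F"
      using x(2) pq subfield_closed(3)[OF f] by (auto simp: constants_def polys_over_def)
  qed
qed

section \<open>The function field of a curve of odd degree\<close>

text \<open>The curve \<open>\<mu>\<^sup>2 + R(\<lambda>) = 0\<close> over a differential field \<open>F\<close>, with \<open>R\<close> of odd degree and constant
  coefficients. Odd degree means that the curve has a single place at infinity, with \<open>\<lambda>\<close> of pole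
  order 2 and \<open>\<mu>\<close> of pole order \<open>2 s + 1\<close>.\<close>
locale odd_curve =
  fixes F :: "'b :: differential_field set" and lam mu :: 'b and R :: "'b poly" and s :: nat
  assumes diff_subfield_F: "diff_subfield F"
    and transcendental_lam: "transcendental_over F lam"
    and der_lam: "\<partial> lam = 0" and der_mu: "\<partial> mu = 0"
    and R_constants: "R \<in> polys_over (constants F)"
    and degree_R: "Polynomial.degree R = 2 * s + 1"
    and mu_square: "mu ^ 2 = - poly R lam"
begin

abbreviation F_lam :: "'b set" where "F_lam \<equiv> adjoin F lam"

abbreviation F_curve :: "'b set" where "F_curve \<equiv> adjoin F_lam mu"

lemma subring_F: "is_subring F"
  using diff_subfield_F by (auto simp: diff_subfield_iff is_subfield_def)

lemma R_polys_over: "R \<in> polys_over F"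
  using R_constants by (auto simp: polys_over_def constants_def)

lemmas polys_closed = polys_over_closed[OF subring_F]

lemma subfield_F_lam: "is_subfield F_lam"
  by (rule subfield_adjoin[OF subring_F])

lemmas F_lam_closed = subfield_closed[OF subfield_F_lam] subring_closed[OF subfield_closed(1)[OF subfield_F_lam]]

lemma lam_in_F_lam: "lam \<in> F_lam" and F_subset_F_lam: "F \<subseteq> F_lam"
  using subset_adjoin[OF subring_F] by auto

lemma diff_subfield_F_lam: "diff_subfield F_lam"
  by (rule diff_subfield_adjoin[OF diff_subfield_F]) (simp add: der_lam F_lam_closed)

lemma der_in_F_lam: "x \<in> F_lam \<Longrightarrow> \<partial> x \<in> F_lam"
  using diff_subfield_F_lam by (auto simp: diff_subfield_iff)

lemma poly_in_F_lam: "p \<in> polys_over F \<Longrightarrow> poly p lam \<in> F_lam"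
  using adjoinI[of p F 1 lam] polys_closed(2) by simp

lemma poly_lam_eq_0_iff: "p \<in> polys_over F \<Longrightarrow> poly p lam = 0 \<longleftrightarrow> p = 0"
  using transcendental_lam by (auto simp: transcendental_over_def)

text \<open>The degree of \<open>x \<in> F(\<lambda>)\<close> in \<open>\<lambda>\<close> is at most \<open>m\<close>. The relation also holds for \<open>x = 0\<close> and every
  \<open>m\<close>, negative ones included, which saves case distinctions; \<open>deg_eq\<close> below bounds the degree from both
  sides by bounding that of the inverse.\<close>
definition deg_le :: "int \<Rightarrow> 'b \<Rightarrow> bool" where
  "deg_le m x \<longleftrightarrow> (\<exists>p\<in>polys_over F. \<exists>q\<in>polys_over F. q \<noteq> 0 \<and> x = poly p lam / poly q lam \<and>
     int (Polynomial.degree p) \<le> int (Polynomial.degree q) + m)"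

lemma deg_leI:
  assumes "p \<in> polys_over F" "q \<in> polys_over F" "q \<noteq> 0" "x = poly p lam / poly q lam"
    "int (Polynomial.degree p) \<le> int (Polynomial.degree q) + m"
  shows "deg_le m x"
  unfolding deg_le_def using assms by blast

lemma deg_leE:
  assumes "deg_le m x"
  obtains p q where "p \<in> polys_over F" "q \<in> polys_over F" "q \<noteq> 0" "poly q lam \<noteq> 0"
    "x = poly p lam / poly q lam" "int (Polynomial.degree p) \<le> int (Polynomial.degree q) + m"
  using assms poly_lam_eq_0_iff unfolding deg_le_def by blast

lemma deg_le_mono: "deg_le m x \<Longrightarrow> m \<le> n \<Longrightarrow> deg_le n x"
  by (erule deg_leE) (rule deg_leI, auto)

lemma deg_le_add:
  assumes "deg_le m x" "deg_le m y"
  shows "deg_le m (x + y)"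
proof -
  obtain p q where x: "p \<in> polys_over F" "q \<in> polys_over F" "q \<noteq> 0" "poly q lam \<noteq> 0"
    "x = poly p lam / poly q lam" "int (Polynomial.degree p) \<le> int (Polynomial.degree q) + m"
    using assms(1) by (rule deg_leE)
  obtain p' q' where y: "p' \<in> polys_over F" "q' \<in> polys_over F" "q' \<noteq> 0" "poly q' lam \<noteq> 0"
    "y = poly p' lam / poly q' lam" "int (Polynomial.degree p') \<le> int (Polynomial.degree q') + m"
    using assms(2) by (rule deg_leE)
  show ?thesis
  proof (rule deg_leI)
    show "p * q' + p' * q \<in> polys_over F" "q * q' \<in> polys_over F" "q * q' \<noteq> 0"
      using x y by (auto intro!: polys_closed)
    show "x + y = poly (p * q' + p' * q) lam / poly (q * q') lam"
      using x y by (simp add: add_frac_eq)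
    show "int (Polynomial.degree (p * q' + p' * q)) \<le> int (Polynomial.degree (q * q')) + m"
      using x(6) y(6) degree_add_le_max[of "p * q'" "p' * q"] degree_mult_le[of p q'] degree_mult_le[of p' q]
        degree_mult_eq[OF x(3) y(3)] by linarith
  qed
qed

lemma deg_le_mult:
  assumes "deg_le m x" "deg_le n y"
  shows "deg_le (m + n) (x * y)"
proof -
  obtain p q where x: "p \<in> polys_over F" "q \<in> polys_over F" "q \<noteq> 0" "poly q lam \<noteq> 0"
    "x = poly p lam / poly q lam" "int (Polynomial.degree p) \<le> int (Polynomial.degree q) + m"
    using assms(1) by (rule deg_leE)
  obtain p' q' where y: "p' \<in> polys_over F" "q' \<in> polys_over F" "q' \<noteq> 0" "poly q' lam \<noteq> 0"
    "y = poly p' lam / poly q' lam" "int (Polynomial.degree p') \<le> int (Polynomial.degree q') + n"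
    using assms(2) by (rule deg_leE)
  show ?thesis
  proof (rule deg_leI)
    show "p * p' \<in> polys_over F" "q * q' \<in> polys_over F" "q * q' \<noteq> 0"
      using x y by (auto intro!: polys_closed)
    show "x * y = poly (p * p') lam / poly (q * q') lam"
      using x y by simp
    show "int (Polynomial.degree (p * p')) \<le> int (Polynomial.degree (q * q')) + (m + n)"
      using x(6) y(6) degree_mult_le[of p p'] degree_mult_eq[OF x(3) y(3)] by linarith
  qed
qed

lemma deg_le_minus: "deg_le m x \<Longrightarrow> deg_le m (- x)"
  by (erule deg_leE) (rule deg_leI[where p = "- p" for p], auto intro: polys_closed)

lemma deg_le_diff: "deg_le m x \<Longrightarrow> deg_le m y \<Longrightarrow> deg_le m (x - y)"
  using deg_le_add[of m x "- y"] deg_le_minus[of m y] by simp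

lemma deg_le_poly:
  assumes "p \<in> polys_over F"
  shows "deg_le (int (Polynomial.degree p)) (poly p lam)"
  by (rule deg_leI[OF assms polys_closed(2)]) auto

lemma deg_le_F: "a \<in> F \<Longrightarrow> deg_le 0 a"
  using deg_le_poly[of "[:a:]"] by (auto intro!: polys_closed)

lemma deg_le_0: "deg_le m 0"
  \<comment> \<open>for \<open>m < 0\<close> the denominator supplies the degree\<close>
proof (rule deg_leI[where p = 0 and q = "Polynomial.monom 1 (nat (- m))"])
  show "Polynomial.monom 1 (nat (- m)) \<in> polys_over F"
    using subring_closed[OF subring_F] by (auto simp: polys_over_def)
qed (auto simp: degree_monom_eq intro: polys_closed)

text \<open>As \<open>\<lambda>\<close> is constant, \<open>\<partial>\<close> acts on the coefficients and cannot raise the degree. All the obstructions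
  below come from this.\<close>
lemma deg_le_der:
  assumes "deg_le m x"
  shows "deg_le m (\<partial> x)"
proof -
  obtain p q where x: "p \<in> polys_over F" "q \<in> polys_over F" "q \<noteq> 0" "poly q lam \<noteq> 0"
    "x = poly p lam / poly q lam" "int (Polynomial.degree p) \<le> int (Polynomial.degree q) + m"
    using assms by (rule deg_leE)
  note d = map_der_polys_over[OF diff_subfield_F]
  show ?thesis
  proof (rule deg_leI)
    show "map_poly \<partial> p * q - p * map_poly \<partial> q \<in> polys_over F" "q * q \<in> polys_over F" "q * q \<noteq> 0"
      using x d by (auto intro!: polys_closed)
    show "\<partial> x = poly (map_poly \<partial> p * q - p * map_poly \<partial> q) lam / poly (q * q) lam"
      using x(4) by (simp add: x(5) der_divide der_poly der_lam power2_eq_square)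
    show "int (Polynomial.degree (map_poly \<partial> p * q - p * map_poly \<partial> q)) \<le> int (Polynomial.degree (q * q)) + m"
      using x(6) degree_diff_le_max[of "map_poly \<partial> p * q" "p * map_poly \<partial> q"] degree_mult_le[of "map_poly \<partial> p" q]
        degree_mult_le[of p "map_poly \<partial> q"] map_poly_degree_leq[of \<partial> p] map_poly_degree_leq[of \<partial> q]
        degree_mult_eq[OF x(3) x(3)] by linarith
  qed
qed

lemma deg_le_1D:
  assumes "deg_le m 1"
  shows "m \<ge> 0"
proof -
  obtain p q where x: "p \<in> polys_over F" "q \<in> polys_over F" "q \<noteq> 0" "poly q lam \<noteq> 0"
    "1 = poly p lam / poly q lam" "int (Polynomial.degree p) \<le> int (Polynomial.degree q) + m"
    using assms by (rule deg_leE)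
  have "poly (p - q) lam = 0" using x(4,5) by simp
  then have "p = q" using x(1,2) polys_closed(5) poly_lam_eq_0_iff[of "p - q"] by simp
  then show ?thesis using x(6) by simp
qed

definition deg_eq :: "int \<Rightarrow> 'b \<Rightarrow> bool" where
  "deg_eq m x \<longleftrightarrow> x \<noteq> 0 \<and> deg_le m x \<and> deg_le (- m) (inverse x)"

lemma deg_eq_le: "deg_eq m x \<Longrightarrow> deg_le n x \<Longrightarrow> m \<le> n"
  using deg_le_mult[of n x "- m" "inverse x"] deg_le_1D[of "n - m"] by (auto simp: deg_eq_def)

lemma deg_eq_mult: "deg_eq m x \<Longrightarrow> deg_eq n y \<Longrightarrow> deg_eq (m + n) (x * y)"
  using deg_le_mult[of m x n y] deg_le_mult[of "- m" "inverse x" "- n" "inverse y"]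
  by (auto simp: deg_eq_def)

lemma deg_le_cancel:
  assumes "deg_eq m x" "deg_le n (x * y)"
  shows "deg_le (n - m) y"
  using deg_le_mult[of "- m" "inverse x" n "x * y"] assms
  by (auto simp: deg_eq_def simp flip: mult.assoc)

lemma deg_eq_exists:
  assumes "x \<in> F_lam" "x \<noteq> 0"
  obtains m where "deg_eq m x"
proof -
  obtain p q where x: "p \<in> polys_over F" "q \<in> polys_over F" "poly q lam \<noteq> 0" "x = poly p lam / poly q lam"
    using assms(1) by (rule adjoinE)
  have "p \<noteq> 0" "q \<noteq> 0" using x assms(2) by auto
  then have "deg_eq (int (Polynomial.degree p) - int (Polynomial.degree q)) x"
    unfolding deg_eq_def using x assms(2) by (auto intro: deg_leI[of p q] deg_leI[of q p])
  then show thesis by (rule that)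
qed

lemma deg_eq_poly:
  assumes "p \<in> polys_over F" "p \<noteq> 0"
  shows "deg_eq (int (Polynomial.degree p)) (poly p lam)"
  unfolding deg_eq_def
  using assms deg_le_poly[OF assms(1)] deg_leI[OF polys_closed(2) assms, of "inverse (poly p lam)"]
  by (auto simp: poly_lam_eq_0_iff divide_inverse)

lemma deg_eq_lam: "deg_eq 1 lam"
  using deg_eq_poly[of "[:0, 1:]"] subring_closed[OF subring_F] by (auto intro!: polys_closed)

lemma deg_eq_R: "deg_eq (2 * int s + 1) (poly R lam)"
proof -
  have "R \<noteq> 0" using degree_R by auto
  then have "deg_eq (int (2 * s + 1)) (poly R lam)"
    using deg_eq_poly[OF R_polys_over] degree_R by metis
  then show ?thesis by (simp add: add.commute)
qed

text \<open>The square of \<open>\<mu>\<close> has odd degree.\<close>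
lemma mu_notin_F_lam: "mu \<notin> F_lam"
proof
  assume "mu \<in> F_lam"
  have sq: "poly R lam = - (mu * mu)"
    using mu_square by (simp add: power2_eq_square)
  have "mu \<noteq> 0" using sq deg_eq_R by (auto simp: deg_eq_def)
  then obtain m where m: "deg_eq m mu" using deg_eq_exists[OF \<open>mu \<in> F_lam\<close>] by blast
  have "deg_le (m + m) (poly R lam)" "deg_le (2 * int s + 1) (mu * mu)"
    using deg_eq_mult[OF m m] deg_eq_R deg_le_minus[of _ "mu * mu"] deg_le_minus[of _ "- (mu * mu)"]
    unfolding sq deg_eq_def by auto
  then have "2 * int s + 1 \<le> m + m" "m + m \<le> 2 * int s + 1"
    using deg_eq_le[OF deg_eq_R] deg_eq_le[OF deg_eq_mult[OF m m]] by blast+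
  then show False by presburger
qed

lemma mu_square_in_F_lam: "mu ^ 2 \<in> F_lam"
  unfolding mu_square by (intro F_lam_closed poly_in_F_lam R_polys_over)

lemma F_curveE:
  assumes "x \<in> F_curve"
  obtains a b where "a \<in> F_lam" "b \<in> F_lam" "x = a + b * mu"
  by (rule adjoin_sqrtE[OF subfield_F_lam mu_square_in_F_lam mu_notin_F_lam assms])

lemma mu_independent:
  assumes "a \<in> F_lam" "b \<in> F_lam" "a + b * mu = 0"
  shows "a = 0" "b = 0"
proof -
  show "b = 0"
  proof (rule ccontr)
    assume "b \<noteq> 0"
    then have "mu = - a / b"
      using assms(3) by (simp add: field_simps eq_neg_iff_add_eq_0)
    with assms F_lam_closed mu_notin_F_lam show False by metis
  qed
  then show "a = 0" using assms(3) by simp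
qed

lemma subfield_F_curve: "is_subfield F_curve"
  by (rule subfield_adjoin[OF F_lam_closed(1)])

lemma F_lam_subset_F_curve: "F_lam \<subseteq> F_curve" and mu_in_F_curve: "mu \<in> F_curve"
  using subset_adjoin[OF F_lam_closed(1)] by auto

lemma diff_subfield_F_curve: "diff_subfield F_curve"
  by (rule diff_subfield_adjoin[OF diff_subfield_F_lam])
     (use F_lam_subset_F_curve F_lam_closed in \<open>auto simp: der_mu\<close>)

text \<open>Since \<open>1, \<mu>\<close> are independent over \<open>F(\<lambda>)\<close>, both coordinates of a constant are constants, and the
  constants of \<open>F(\<lambda>)\<close> are known from \<open>constants_adjoin_constant\<close>.\<close>
lemma constants_F_curve: "constants F_curve = adjoin (adjoin (constants F) lam) mu"
proof
  let ?C = "constants F"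
  have C: "is_subring ?C"
    using subfield_constants diff_subfield_F subfield_closed(1) by (auto simp: diff_subfield_iff)
  note C_lam = subfield_adjoin[OF C, of lam]
  note C_curve = subfield_adjoin[OF subfield_closed(1)[OF C_lam], of mu]
  show "adjoin (adjoin ?C lam) mu \<subseteq> constants F_curve"
  proof (intro adjoin_subset subfield_constants subfield_F_curve)
  qed (use F_subset_F_lam lam_in_F_lam F_lam_subset_F_curve mu_in_F_curve in \<open>auto simp: constants_def der_lam der_mu\<close>)
  show "constants F_curve \<subseteq> adjoin (adjoin ?C lam) mu"
  proof
    fix x assume "x \<in> constants F_curve"
    then have x: "x \<in> F_curve" "\<partial> x = 0" by (auto simp: constants_def)
    obtain a b where ab: "a \<in> F_lam" "b \<in> F_lam" "x = a + b * mu" using x(1) by (rule F_curveE)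
    have "\<partial> a + \<partial> b * mu = 0" using x(2) ab(3) by (simp add: der_add der_mult der_mu)
    then have "\<partial> a = 0" "\<partial> b = 0"
      using mu_independent[OF der_in_F_lam[OF ab(1)] der_in_F_lam[OF ab(2)]] by auto
    then have "a \<in> adjoin ?C lam" "b \<in> adjoin ?C lam"
      using constants_adjoin_constant[OF diff_subfield_F transcendental_lam der_lam] ab by auto
    then have "a \<in> adjoin (adjoin ?C lam) mu" "b \<in> adjoin (adjoin ?C lam) mu"
      "mu \<in> adjoin (adjoin ?C lam) mu"
      using subset_adjoin[OF subfield_closed(1)[OF C_lam]] by auto
    then show "x \<in> adjoin (adjoin ?C lam) mu"
      unfolding ab(3) using subring_closed[OF subfield_closed(1)[OF C_curve]] by blast
  qed
qed

section \<open>Solutions of the Riccati equation on the curve\<close>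

text \<open>Since \<open>1, \<mu>\<close> are independent over \<open>F(\<lambda>)\<close>, the two components of the equation hold separately.\<close>
lemma riccati_components:
  assumes \<phi>: "\<phi> \<in> F_curve" and U: "U \<in> F" and riccati: "\<partial> \<phi> + \<phi> ^ 2 = U - lam"
  obtains p r where "p \<in> F_lam" "r \<in> F_lam" "\<phi> = p + r * mu" "\<partial> r = - 2 * p * r"
    "\<partial> p + p ^ 2 - r ^ 2 * poly R lam = U - lam"
proof -
  obtain p r where pr: "p \<in> F_lam" "r \<in> F_lam" "\<phi> = p + r * mu" using \<phi> by (rule F_curveE)
  let ?a = "\<partial> p + p * p - r * r * poly R lam - U + lam" and ?b = "\<partial> r + (p * r + p * r)"
  have "?a + ?b * mu = \<partial> \<phi> + \<phi> ^ 2 - U + lam + r * r * (- poly R lam - mu ^ 2)"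
    by (simp add: pr(3) der_add der_mult der_mu algebra_simps power2_eq_square)
  also have "\<dots> = 0"
    by (simp add: riccati mu_square)
  finally have "?a + ?b * mu = 0" .
  moreover have "?a \<in> F_lam" "?b \<in> F_lam"
    by (intro F_lam_closed pr lam_in_F_lam der_in_F_lam poly_in_F_lam R_polys_over
        subsetD[OF F_subset_F_lam U])+
  ultimately have "?a = 0" "?b = 0" using mu_independent by blast+
  then have "\<partial> r = - 2 * p * r" "\<partial> p + p ^ 2 - r ^ 2 * poly R lam = U - lam"
    by (simp_all add: algebra_simps power2_eq_square eq_neg_iff_add_eq_0)
  with pr show thesis by (rule that)
qed

text \<open>If \<open>p\<close> had positive degree, \<open>p\<^sup>2\<close> would dominate \<open>\<partial> p\<close> and have even degree, while \<open>U - \<lambda>\<close> has degree 1;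
  otherwise the left side has degree at most 0. So a solution on the curve has a nonzero
  \<open>\<mu>\<close>-component.\<close>
lemma riccati_not_rational:
  assumes p: "p \<in> F_lam" and U: "U \<in> F"
  shows "\<partial> p + p ^ 2 \<noteq> U - lam"
proof
  assume eq: "\<partial> p + p ^ 2 = U - lam"
  have "deg_le 0 p"
  proof (cases "p = 0")
    case False
    then obtain m where m: "deg_eq m p" using deg_eq_exists[OF p] by blast
    have "p * p = U - \<partial> p - lam"
      using eq by (simp add: algebra_simps power2_eq_square)
    moreover have "deg_le (max 1 m) (U - \<partial> p - lam)"
      using deg_le_mono[OF deg_le_F[OF U], of "max 1 m"] deg_le_mono[OF deg_le_der, of m p "max 1 m"] m
        deg_le_mono[of 1 lam "max 1 m"] deg_eq_lam
      by (auto simp: deg_eq_def intro!: deg_le_diff)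
    ultimately have "m + m \<le> max 1 m"
      using deg_eq_le[OF deg_eq_mult[OF m m]] by simp
    then show ?thesis using m deg_le_mono[of m p 0] by (auto simp: deg_eq_def)
  qed (simp add: deg_le_0)
  then have "deg_le 0 (U - \<partial> p - p * p)"
    using deg_le_F[OF U] deg_le_der[of 0 p] deg_le_mult[of 0 p 0 p] by (auto intro!: deg_le_diff)
  moreover have "U - \<partial> p - p * p = lam"
    using eq by (simp add: algebra_simps power2_eq_square)
  ultimately show False using deg_eq_le[OF deg_eq_lam] by fastforce
qed

text \<open>From \<open>p = - \<partial> r / (2 r)\<close> the degree of \<open>p\<close> is at most 0. Then \<open>\<lambda>\<close> can only be balanced by
  \<open>r\<^sup>2 R(\<lambda>)\<close>, so \<open>2 deg r + 2 s + 1 = 1\<close>. In terms of the place at infinity, \<open>\<phi>\<close> has a simple pole there.\<close>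
lemma riccati_degrees:
  assumes p: "p \<in> F_lam" and r: "r \<in> F_lam" "r \<noteq> 0" and U: "U \<in> F" and der_r: "\<partial> r = - 2 * p * r"
    and eq: "\<partial> p + p ^ 2 - r ^ 2 * poly R lam = U - lam"
  shows "deg_le 0 p" "deg_eq (- int s) r"
proof -
  obtain m where m: "deg_eq m r" using deg_eq_exists[OF r] by blast
  have half: "inverse 2 \<in> F" using diff_subfield_F
    using subring_closed[OF subring_F] unfolding diff_subfield_def by (metis one_add_one)
  have "r * p = - (inverse 2 * \<partial> r)"
    by (simp add: der_r)
  moreover have "deg_le m (- (inverse 2 * \<partial> r))"
    using deg_le_mult[OF deg_le_F[OF half] deg_le_der[of m r]] m by (auto simp: deg_eq_def intro: deg_le_minus)
  ultimately show p0: "deg_le 0 p"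
    using deg_le_cancel[OF m, of m p] by simp
  \<comment> \<open>the terms of the equation that stay bounded at infinity\<close>
  define w where "w = \<partial> p + p * p - U"
  have w: "deg_le 0 w"
    using deg_le_F[OF U] deg_le_der[of 0 p] deg_le_mult[of 0 p 0 p] p0
    unfolding w_def by (auto intro!: deg_le_diff deg_le_add)
  have eq': "r * r * poly R lam = w + lam" "lam = r * r * poly R lam - w"
    using eq by (simp_all add: w_def algebra_simps power2_eq_square)
  note d = deg_eq_mult[OF deg_eq_mult[OF m m] deg_eq_R]
  have "deg_le 1 (w + lam)"
    using deg_le_mono[OF w, of 1] deg_eq_lam by (auto simp: deg_eq_def intro!: deg_le_add)
  then have 1: "m + m + (2 * int s + 1) \<le> 1"
    using deg_eq_le[OF d] eq'(1) by simp
  define n where "n = max 0 (m + m + (2 * int s + 1))"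
  have "deg_le n (r * r * poly R lam - w)"
    using deg_le_mono[OF w, of n] deg_le_mono[of _ "r * r * poly R lam" n] d
    by (auto simp: deg_eq_def n_def intro!: deg_le_diff)
  then have "1 \<le> n"
    using deg_eq_le[OF deg_eq_lam] eq'(2) by simp
  then have "m = - int s" using 1 by (auto simp: n_def)
  then show "deg_eq (- int s) r" using m by simp
qed

text \<open>At infinity \<open>\<phi>\<close> has a pole, so \<open>n \<phi> g\<close> has larger pole order than \<open>g\<close>, whereas \<open>\<partial> g\<close> does not. In
  coordinates \<open>g = a + b \<mu>\<close>, the equation for the \<open>\<mu>\<close>-component gives \<open>deg a \<le> deg b + s\<close> and the other
  one gives \<open>deg b \<le> deg a - s - 1\<close>, which leaves only \<open>g = 0\<close>.\<close>
lemma riccati_no_exponentials: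
  assumes \<phi>: "\<phi> \<in> F_curve" and U: "U \<in> F" and riccati: "\<partial> \<phi> + \<phi> ^ 2 = U - lam"
  shows "no_exponentials F_curve \<phi>"
  unfolding no_exponentials_def
proof (intro ballI allI impI)
  fix g and n :: int
  assume g: "g \<in> F_curve" and n: "n \<noteq> 0" and der_g: "\<partial> g = of_int n * \<phi> * g"
  obtain p r where pr: "p \<in> F_lam" "r \<in> F_lam" "\<phi> = p + r * mu" "\<partial> r = - 2 * p * r"
    and eq: "\<partial> p + p ^ 2 - r ^ 2 * poly R lam = U - lam"
    using riccati_components[OF assms] .
  have "r \<noteq> 0" using riccati_not_rational[OF pr(1) U] eq by auto
  note deg = riccati_degrees[OF pr(1,2) this U pr(4) eq]
  obtain a b where ab: "a \<in> F_lam" "b \<in> F_lam" "g = a + b * mu" using g by (rule F_curveE)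
  define c :: 'b where "c = of_int n"
  have c: "c \<in> F" "c \<noteq> 0" "inverse c \<in> F"
  proof -
    show "c \<in> F"
      unfolding c_def using subring_of_nat[OF subring_F] subring_closed[OF subring_F]
      by (cases n rule: int_cases2) auto
    then show "inverse c \<in> F" using diff_subfield_F by (auto simp: diff_subfield_def)
    show "c \<noteq> 0" using n by (simp add: c_def)
  qed
  have cF: "c \<in> F_lam" "inverse c \<in> F_lam" using c F_subset_F_lam by auto
  \<comment> \<open>the two components of \<open>\<partial> g - n \<phi> g\<close>\<close>
  let ?A = "\<partial> a - c * (p * a - r * b * poly R lam)" and ?B = "\<partial> b - c * (p * b + r * a)"
  have "?A + ?B * mu = \<partial> g - c * \<phi> * g + c * r * b * (mu ^ 2 + poly R lam)"
    by (simp add: ab(3) pr(3) der_add der_mult der_mu algebra_simps power2_eq_square)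
  also have "\<dots> = 0" by (simp add: der_g mu_square c_def)
  finally have "?A + ?B * mu = 0" .
  moreover have "?A \<in> F_lam" "?B \<in> F_lam"
    by (intro F_lam_closed pr ab cF der_in_F_lam poly_in_F_lam R_polys_over)+
  ultimately have "?A = 0" "?B = 0" using mu_independent by blast+
  then have ra: "r * a = inverse c * \<partial> b - p * b" and Rb: "poly R lam * r * b = p * a - inverse c * \<partial> a"
    using c(2) by (auto simp: field_simps)
  have bound: "deg_le m (inverse c * \<partial> x)" "deg_le m (p * x)" if "deg_le m x" for m x
    using deg_le_mult[OF deg_le_F[OF c(3)] deg_le_der[OF that]] deg_le_mult[OF deg(1) that] by auto
  have a_bound: "deg_le (m + int s) a" if "deg_le m b" for m
    using deg_le_cancel[OF deg(2), of m a] bound[OF that] unfolding ra by (auto intro: deg_le_diff)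
  have b_bound: "deg_le (m - int s - 1) b" if "deg_le m a" for m
    using deg_le_cancel[OF deg_eq_mult[OF deg_eq_R deg(2)], of m b] bound[OF that]
    unfolding Rb by (auto intro: deg_le_diff simp: algebra_simps)
  have "b = 0"
  proof (rule ccontr)
    assume "b \<noteq> 0"
    then obtain m where m: "deg_eq m b" using deg_eq_exists[OF ab(2)] by blast
    then have "deg_le m b" by (simp add: deg_eq_def)
    from b_bound[OF a_bound[OF this]] have "deg_le (m - 1) b" by simp
    then show False using deg_eq_le[OF m] by fastforce
  qed
  moreover from this have "a = 0" using ra \<open>r \<noteq> 0\<close> by simp
  ultimately show "g = 0" using ab(3) by simp
qed

text \<open>The conjugate \<open>\<phi>' = p - r \<mu>\<close> solves the same Riccati equation. Its exponential is \<open>1 / (r \<Psi>)\<close>: the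
  logarithmic derivative of \<open>r\<close> is \<open>- 2 p = - (\<phi> + \<phi>')\<close>.\<close>
lemma conjugate_solution:
  assumes \<phi>: "\<phi> \<in> F_curve" and U: "U \<in> F" and riccati: "\<partial> \<phi> + \<phi> ^ 2 = U - lam"
    and \<Psi>: "\<Psi> \<noteq> 0" "\<partial> \<Psi> = \<phi> * \<Psi>"
  obtains \<Psi>' \<phi>' where "\<Psi>' \<in> adjoin F_curve \<Psi>" "\<Psi>' \<noteq> 0" "\<partial> \<Psi>' = \<phi>' * \<Psi>'" "\<phi>' \<noteq> \<phi>"
    "\<partial> \<phi>' + \<phi>' ^ 2 = U - lam"
proof -
  obtain p r where pr: "p \<in> F_lam" "r \<in> F_lam" "\<phi> = p + r * mu" "\<partial> r = - 2 * p * r"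
    and eq: "\<partial> p + p ^ 2 - r ^ 2 * poly R lam = U - lam"
    using riccati_components[OF \<phi> U riccati] .
  have r: "r \<noteq> 0" using riccati_not_rational[OF pr(1) U] eq by auto
  have "mu \<noteq> 0" using mu_notin_F_lam F_lam_closed by auto
  note c = subfield_closed[OF subfield_adjoin[OF subfield_closed(1)[OF subfield_F_curve], of \<Psi>]]
  note sub = subset_adjoin[OF subfield_closed(1)[OF subfield_F_curve], of \<Psi>]
  show thesis
  proof (rule that[of "inverse (r * \<Psi>)" "p - r * mu"])
    show "inverse (r * \<Psi>) \<in> adjoin F_curve \<Psi>"
      using sub pr(2) F_lam_subset_F_curve by (intro c subring_closed(4)[OF c(1)]) auto
    show "inverse (r * \<Psi>) \<noteq> 0" using r \<Psi> by simp
    have "\<partial> (r * \<Psi>) = - ((2 * p - \<phi>) * (r * \<Psi>))"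
      by (simp add: der_mult pr(4) \<Psi>(2) algebra_simps)
    then have "\<partial> (inverse (r * \<Psi>)) = (2 * p - \<phi>) * (r * \<Psi>) / (r * \<Psi>) ^ 2"
      using r \<Psi>(1) by (subst der_inverse) simp_all
    also have "\<dots> = (2 * p - \<phi>) * inverse (r * \<Psi>)"
      by (simp add: power2_eq_square inverse_eq_divide del: mult_eq_0_iff)
    also have "2 * p - \<phi> = p - r * mu" by (simp add: pr(3))
    finally show "\<partial> (inverse (r * \<Psi>)) = (p - r * mu) * inverse (r * \<Psi>)" .
    show "p - r * mu \<noteq> \<phi>"
    proof
      assume "p - r * mu = \<phi>"
      then have "2 * (r * mu) = 0" unfolding pr(3) by (simp add: algebra_simps)
      with r \<open>mu \<noteq> 0\<close> show False by simp
    qed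
    have "\<partial> (p - r * mu) + (p - r * mu) ^ 2 = \<partial> p + p ^ 2 + r ^ 2 * mu ^ 2"
      by (simp add: der_diff der_mult der_mu pr(4) algebra_simps power2_eq_square)
    also have "\<dots> = U - lam" using eq by (simp add: mu_square)
    finally show "\<partial> (p - r * mu) + (p - r * mu) ^ 2 = U - lam" .
  qed
qed

end

section \<open>The curve field as a double simple extension\<close>

text \<open>Coefficients can be lifted one at a time; zero is lifted to zero to keep the polynomial
  finite.\<close>
lemma image_polys_over:
  assumes "0 \<in> S" "h 0 = 0"
  shows "map_poly h ` polys_over S = polys_over (h ` S)"
proof
  show "map_poly h ` polys_over S \<subseteq> polys_over (h ` S)"
    using assms by (auto simp: polys_over_def coeff_map_poly)
  show "polys_over (h ` S) \<subseteq> map_poly h ` polys_over S"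
  proof
    fix q assume q: "q \<in> polys_over (h ` S)"
    \<comment> \<open>a section of \<open>h\<close> over \<open>h ` S\<close>\<close>
    define g where "g y = (if y = 0 then 0 else inv_into S h y)" for y
    have g: "g y \<in> S" "h (g y) = y" if "y \<in> h ` S" for y
      using assms that by (auto simp: g_def inv_into_into f_inv_into_f)
    have "map_poly h (map_poly g q) = q"
    proof (rule poly_eqI)
      fix i
      have "g 0 = 0" by (simp add: g_def)
      then show "poly.coeff (map_poly h (map_poly g q)) i = poly.coeff q i"
        using q g assms(2) by (simp add: coeff_map_poly polys_over_def)
    qed
    moreover have "map_poly g q \<in> polys_over S"
    proof -
      have "g 0 = 0" by (simp add: g_def)
      then show ?thesis using q g by (simp add: coeff_map_poly polys_over_def)
    qed
    ultimately show "q \<in> map_poly h ` polys_over S" by (metis imageI)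
  qed
qed

lemma eval2_image:
  assumes "0 \<in> F" "j 0 = 0"
  shows "eval2 j lam mu ` polys2_over F = poly_values (poly_values (j ` F) lam) mu"
proof -
  let ?h = "\<lambda>c. poly (map_poly j c) lam"
  have 0: "0 \<in> polys_over F" "?h 0 = 0" using assms by (auto simp: polys_over_def)
  have "polys2_over F = polys_over (polys_over F)"
    by (simp add: polys2_over_def polys_over_def)
  then have "eval2 j lam mu ` polys2_over F = (\<lambda>p. poly p mu) ` map_poly ?h ` polys_over (polys_over F)"
    by (simp add: eval2_def image_image)
  also have "\<dots> = (\<lambda>p. poly p mu) ` polys_over (?h ` polys_over F)"
    using image_polys_over[of "polys_over F" ?h] 0 by simp
  also have "?h ` polys_over F = (\<lambda>p. poly p lam) ` map_poly j ` polys_over F"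
    by (simp add: image_image)
  also have "\<dots> = poly_values (j ` F) lam"
    using image_polys_over[of F j] assms by (simp add: poly_values_def)
  finally show ?thesis by (simp add: poly_values_def)
qed

lemma curve_field_eq_adjoin:
  assumes "0 \<in> F" "j 0 = 0" "is_subring (j ` F)"
  shows "curve_field F j lam mu = adjoin (adjoin (j ` F) lam) mu"
proof -
  let ?V = "poly_values (j ` F) lam"
  note V = subring_poly_values[OF assms(3), of lam]
  note W = subring_poly_values[OF V, of mu]
  have "curve_field F j lam mu = fractions (eval2 j lam mu ` polys2_over F)"
    by (auto simp: curve_field_def fractions_def)
  also have "\<dots> = fractions (poly_values ?V mu)"
    by (simp add: eval2_image assms)
  also have "\<dots> = adjoin (adjoin (j ` F) lam) mu"
  proof
    have "?V \<subseteq> adjoin (j ` F) lam"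
      using subset_fractions[OF V] by (simp add: adjoin_def)
    then have "adjoin ?V mu \<subseteq> adjoin (adjoin (j ` F) lam) mu"
      by (rule adjoin_mono[OF subfield_closed(1)[OF subfield_adjoin[OF assms(3)]]])
    then show "fractions (poly_values ?V mu) \<subseteq> adjoin (adjoin (j ` F) lam) mu"
      by (simp add: adjoin_def[of ?V])
    have "?V \<subseteq> fractions (poly_values ?V mu)" "mu \<in> fractions (poly_values ?V mu)"
      using subset_fractions[OF W] subset_poly_values[OF V, of mu] by auto
    moreover have "j ` F \<subseteq> ?V" "lam \<in> ?V"
      using subset_poly_values[OF assms(3)] by auto
    ultimately show "adjoin (adjoin (j ` F) lam) mu \<subseteq> fractions (poly_values ?V mu)"
      by (intro adjoin_subset subfield_fractions[OF W]) auto
  qed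
  finally show ?thesis .
qed

lemma eval2_pCons: "j 0 = 0 \<Longrightarrow> eval2 j lam mu (pCons c p) = poly (map_poly j c) lam + mu * eval2 j lam mu p"
  by (simp add: eval2_def map_poly_pCons)

text \<open>That the evaluation has kernel \<open>(f)\<close> yields two facts: \<open>f\<close> itself vanishes, and
  \<open>\<lambda>\<close> is transcendental over \<open>j(K)\<close> because a nonzero multiple of \<open>f\<close> has degree at least 2 in \<open>\<mu>\<close>. The
  other conclusions transport \<open>K\<close> and its constants along \<open>j\<close>.\<close>
lemma spectral_embedding_odd_curve:
  fixes j :: "'a :: differential_field \<Rightarrow> 'b :: differential_field"
  assumes K: "diff_subfield K" "constants UNIV \<subseteq> K" and emb: "spectral_embedding K R j lam mu"
    and R: "R \<in> polys_over (constants UNIV)" "Polynomial.degree R = 2 * s + 1"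
  shows "odd_curve (j ` K) lam mu (map_poly j R) s" "j 0 = 0" "constants (j ` K) = j ` constants UNIV"
    "is_subring (j ` constants UNIV)" "j (- 1) = - 1"
proof -
  have sK: "is_subfield K" using K by (simp add: diff_subfield_iff)
  note c = subfield_closed[OF sK] subring_closed[OF subfield_closed(1)[OF sK]]
  have add: "j (x + y) = j x + j y" and mult: "j (x * y) = j x * j y" if "x \<in> K" "y \<in> K" for x y
    using emb that by (auto simp: spectral_embedding_def)
  have der: "j (\<partial> x) = \<partial> (j x)" if "x \<in> K" for x
    using emb that by (auto simp: spectral_embedding_def)
  have one: "j 1 = 1" using emb by (simp add: spectral_embedding_def)
  show zero: "j 0 = 0"
    using add[OF c(4) c(4)] by simp
  have minus: "j (- x) = - j x" if "x \<in> K" for x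
    using add[of x "- x"] that c zero by (simp add: eq_neg_iff_add_eq_0 add.commute)
  then show "j (- 1) = - 1" using one c by simp
  have nz: "j x = 0 \<longleftrightarrow> x = 0" if "x \<in> K" for x
    using mult[of x "inverse x"] that c(2) one zero by (cases "x = 0") auto
  have inv: "j (inverse x) = inverse (j x)" if "x \<in> K" for x
  proof (cases "x = 0")
    case False
    then have "j x * j (inverse x) = 1"
      using mult[of x "inverse x"] that c(2) one by simp
    then show ?thesis by (metis inverse_unique)
  qed (simp add: zero)
  have ring: "is_subring (j ` S)" if "is_subring S" "S \<subseteq> K" for S
    unfolding is_subring_def
    using that(2) subring_closed[OF that(1)]
    by (auto simp flip: zero one add mult minus simp: subset_iff intro: image_eqI[OF refl])
  have dF: "diff_subfield (j ` K)"
    unfolding diff_subfield_iff is_subfield_def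
    using ring[OF c(1)] K(1) by (auto simp: diff_subfield_def simp flip: inv der)
  have C: "is_subfield (constants (UNIV :: 'a set))"
    by (rule subfield_constants) (auto simp: is_subfield_def is_subring_def)
  show "is_subring (j ` constants UNIV)"
    using ring[OF subfield_closed(1)[OF C] K(2)] .
  show const: "constants (j ` K) = j ` constants UNIV"
  proof
    have "\<partial> x = 0" if "x \<in> K" "\<partial> (j x) = 0" for x
    proof -
      have "\<partial> x \<in> K" using K(1) that by (auto simp: diff_subfield_def)
      from nz[OF this] der[OF that(1)] that(2) show ?thesis by simp
    qed
    then show "constants (j ` K) \<subseteq> j ` constants UNIV"
      by (auto simp: constants_def)
    have "\<partial> (j x) = 0" if "x \<in> constants UNIV" for x
    proof -
      have "x \<in> K" "\<partial> x = 0" using that K(2) by (auto simp: constants_def)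
      then show ?thesis using der[of x] zero by simp
    qed
    then show "j ` constants UNIV \<subseteq> constants (j ` K)"
      using K(2) by (auto simp: constants_def[of "j ` K"])
  qed
  have ker: "eval2 j lam mu p = 0 \<longleftrightarrow> (\<exists>q\<in>polys2_over K. p = q * spectral_poly R)" if "p \<in> polys2_over K" for p
    using emb that by (simp add: spectral_embedding_def)
  have RK: "R \<in> polys_over K" using R(1) K(2) by (auto simp: polys_over_def)
  show "odd_curve (j ` K) lam mu (map_poly j R) s"
  proof
    show "diff_subfield (j ` K)" by (rule dF)
    show "\<partial> lam = 0" "\<partial> mu = 0" using emb by (auto simp: spectral_embedding_def)
    show "map_poly j R \<in> polys_over (constants (j ` K))"
      using R(1) zero unfolding const by (auto simp: polys_over_def coeff_map_poly)
    have "R \<noteq> 0" using R(2) by auto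
    then have "j (Polynomial.lead_coeff R) \<noteq> 0"
      using nz RK by (auto simp: polys_over_def)
    then show "Polynomial.degree (map_poly j R) = 2 * s + 1"
      using R(2) by (simp add: map_poly_degree_eq)
    have "spectral_poly R \<in> polys2_over K" "1 \<in> polys2_over K"
      using RK c unfolding spectral_poly_def
      by (auto simp: polys2_over_def coeff_pCons polys_over_closed(1,2)[OF c(1)] split: nat.split)
    then have "eval2 j lam mu (spectral_poly R) = 0"
      using ker[of "spectral_poly R"] by force
    moreover have "eval2 j lam mu (spectral_poly R) = poly (map_poly j R) lam + mu * mu"
      by (simp add: spectral_poly_def eval2_pCons zero one eval2_def map_poly_pCons)
    ultimately show "mu ^ 2 = - poly (map_poly j R) lam"
      by (simp add: power2_eq_square eq_neg_iff_add_eq_0 add.commute)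
    show "transcendental_over (j ` K) lam"
      unfolding transcendental_over_def
    proof (intro ballI impI)
      fix P assume "P \<in> polys_over (j ` K)" and P0: "poly P lam = 0"
      then obtain p where p: "p \<in> polys_over K" "P = map_poly j p"
        using image_polys_over[of K j] zero c by (metis imageE)
      have "[:p:] \<in> polys2_over K"
        using p(1) polys_over_closed(1)[OF c(1)] by (auto simp: polys2_over_def coeff_pCons split: nat.split)
      moreover have "eval2 j lam mu [:p:] = 0"
        using P0 p(2) by (simp add: eval2_def map_poly_pCons zero)
      ultimately obtain q where q: "[:p:] = q * spectral_poly R"
        using ker by blast
      have "q = 0"
      proof (rule ccontr)
        assume "q \<noteq> 0"
        moreover have "spectral_poly R \<noteq> 0" "Polynomial.degree (spectral_poly R) = 2"
          by (auto simp: spectral_poly_def)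
        ultimately have "Polynomial.degree [:p:] \<ge> 2"
          unfolding q by (simp add: degree_mult_eq)
        then show False by simp
      qed
      then show "P = 0" using q p(2) by simp
    qed
  qed
qed

section \<open>The Schroedinger equation\<close>

lemma op_poly_schroedinger: "op_poly (schroedinger u) = [:u, 0, - 1:]"
proof -
  have "op_poly (op_D * op_D :: 'a :: differential_field diff_op) = [:0, 0, 1:]"
    by (simp add: times_diff_op.rep_eq op_D.rep_eq op_mult_def der_shift_def map_poly_pCons)
  then show ?thesis
    by (simp add: schroedinger_def minus_diff_op.rep_eq op_const.rep_eq power2_eq_square)
qed

lemma op_poly_spectral_operator:
  assumes "j 0 = 0" "j (- 1) = - 1"
  shows "op_poly (map_op j (schroedinger u) - op_const lam) = [:j u - lam, 0, - 1:]"
  using assms by (simp add: minus_diff_op.rep_eq map_op.rep_eq op_poly_schroedinger op_const.rep_eq map_poly_pCons)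

lemma op_apply_spectral_operator:
  assumes "j 0 = 0" "j (- 1) = - 1"
  shows "op_apply (map_op j (schroedinger u) - op_const lam) y = (j u - lam) * y - \<partial> (\<partial> y)"
    and "op_order (map_op j (schroedinger u) - op_const lam) = 2"
  by (simp_all add: op_apply_def op_order.rep_eq op_coeff.rep_eq op_poly_spectral_operator[OF assms]
    numeral_2_eq_2)

lemma op_apply_first_order: "op_apply (op_D - op_const \<phi>) y = \<partial> y - \<phi> * y"
proof -
  have "op_poly (op_D - op_const \<phi>) = [:- \<phi>, 1:]"
    by (simp add: minus_diff_op.rep_eq op_D.rep_eq op_const.rep_eq)
  then show ?thesis
    by (simp add: op_apply_def op_order.rep_eq op_coeff.rep_eq)
qed

lemma der2_exponential: "\<partial> y = \<phi> * y \<Longrightarrow> \<partial> (\<partial> y) = (\<partial> \<phi> + \<phi> ^ 2) * y"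
  by (simp add: der_mult algebra_simps power2_eq_square)

text \<open>Two exponentials with different logarithmic derivatives are independent over the constants, since
  their Wronskian is \<open>(\<phi>' - \<phi>) \<Psi> \<Psi>'\<close>.\<close>
lemma fundamental_set_exponentials:
  assumes "\<Psi> \<noteq> 0" "\<partial> \<Psi> = \<phi> * \<Psi>" "\<Psi>' \<noteq> 0" "\<partial> \<Psi>' = \<phi>' * \<Psi>'" "\<phi>' \<noteq> \<phi>"
    and "op_order P = 2" "op_apply P \<Psi> = 0" "op_apply P \<Psi>' = 0"
  shows "fundamental_set P {\<Psi>, \<Psi>'}"
proof -
  have ne: "\<Psi> \<noteq> \<Psi>'" using assms by auto
  have indep: "c = 0 \<and> c' = 0" if c: "\<partial> c = 0" "\<partial> c' = 0" and sum: "c * \<Psi> + c' * \<Psi>' = 0" for c c'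
  proof -
    have "\<partial> (c * \<Psi> + c' * \<Psi>') = c * (\<phi> * \<Psi>) + c' * (\<phi>' * \<Psi>')"
      by (simp add: der_add der_mult c assms(2,4))
    also have "\<dots> = \<phi> * (c * \<Psi> + c' * \<Psi>') + c' * (\<phi>' - \<phi>) * \<Psi>'"
      by (simp add: algebra_simps)
    finally have "c' * (\<phi>' - \<phi>) * \<Psi>' = 0" by (simp add: sum)
    then have "c' = 0" using assms by simp
    with sum assms(1) show ?thesis by simp
  qed
  show ?thesis
    unfolding fundamental_set_def
  proof (intro conjI allI impI)
    fix c assume "(\<forall>y\<in>{\<Psi>, \<Psi>'}. c y \<in> constants UNIV) \<and> (\<Sum>y\<in>{\<Psi>, \<Psi>'}. c y * y) = 0"
    then show "\<forall>y\<in>{\<Psi>, \<Psi>'}. c y = 0"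
      using indep[of "c \<Psi>" "c \<Psi>'"] ne by (simp add: constants_def)
  qed (use ne assms(6-8) in simp_all)
qed

theorem theoremC:
  fixes u :: "'a :: differential_field"
    and A :: "'a diff_op"
    and R :: "'a poly"
    and s :: nat
    and j :: "'a \<Rightarrow> 'b :: differential_field"
    and lam mu \<phi> \<Psi> :: 'b
  defines "C \<equiv> constants (UNIV :: 'a set)"
  defines "K \<equiv> diff_field_gen (C \<union> {u})"
  defines "K\<Gamma> \<equiv> curve_field K j lam mu"
    and "C\<Gamma> \<equiv> curve_field C j lam mu"
  assumes "alg_closed_in_itself C"
    and "u \<notin> C"
    and "algebro_geometric (schroedinger u)"
    and "partner s (schroedinger u) A R"
    and "spectral_embedding K R j lam mu"
    and "differential_closure_of K\<Gamma>"
    and "\<phi> \<in> K\<Gamma>"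
    and "monic_gcrd_over K\<Gamma> (map_op j (schroedinger u) - op_const lam)
           (map_op j A - op_const mu) (op_D - op_const \<phi>)"
    and "\<Psi> \<noteq> 0" and "\<partial> \<Psi> = \<phi> * \<Psi>"
  shows "spectral_picard_vessiot K\<Gamma> C\<Gamma> (map_op j (schroedinger u) - op_const lam)
           (diff_field_gen (K\<Gamma> \<union> {\<Psi>}))"
proof -
  note emb = \<open>spectral_embedding K R j lam mu\<close>
  note \<Psi> = \<open>\<Psi> \<noteq> 0\<close> \<open>\<partial> \<Psi> = \<phi> * \<Psi>\<close>
  have K: "diff_subfield K" "C \<subseteq> K" "u \<in> K"
    using diff_subfield_gen subset_diff_field_gen[of "C \<union> {u}"] by (auto simp: K_def)
  have R: "R \<in> polys_over C" "Polynomial.degree R = 2 * s + 1"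
    using \<open>partner s (schroedinger u) A R\<close> by (auto simp: partner_def C_def)
  note curve = spectral_embedding_odd_curve[OF K(1) K(2)[unfolded C_def] emb R(1)[unfolded C_def] R(2),
      folded C_def]
  interpret odd_curve "j ` K" lam mu "map_poly j R" s
    by (rule curve)
  have "0 \<in> K" "0 \<in> C"
    using K(1) by (auto simp: diff_subfield_def C_def constants_def)
  then have K\<Gamma>: "K\<Gamma> = F_curve" and C\<Gamma>: "C\<Gamma> = adjoin (adjoin (constants (j ` K)) lam) mu"
    using curve_field_eq_adjoin[of K j] curve_field_eq_adjoin[of C j] curve(2-4) subring_F
    by (simp_all add: K\<Gamma>_def C\<Gamma>_def)
  let ?P = "map_op j (schroedinger u) - op_const lam"
  note P = op_apply_spectral_operator[where j = j and u = u and lam = lam, OF curve(2,5)]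
  have sol: "op_apply ?P y = 0" if "\<partial> y = \<chi> * y" "\<partial> \<chi> + \<chi> ^ 2 = j u - lam" for y \<chi>
    using der2_exponential[OF that(1)] that(2) by (simp add: P(1))
  have riccati: "\<partial> \<phi> + \<phi> ^ 2 = j u - lam"
  proof -
    obtain Q where "?P = Q * (op_D - op_const \<phi>)"
      using \<open>monic_gcrd_over K\<Gamma> _ _ _\<close> by (auto simp: monic_gcrd_over_def right_divides_over_def)
    then have "op_apply ?P \<Psi> = op_apply Q 0"
      using \<Psi>(2) by (simp only: op_apply_mult op_apply_first_order) simp
    also have "\<dots> = 0"
    proof -
      have "(\<partial> ^^ i) (0 :: 'b) = 0" for i by (induction i) auto
      then show ?thesis by (simp add: op_apply_def)
    qed
    finally have "(j u - lam - (\<partial> \<phi> + \<phi> ^ 2)) * \<Psi> = 0"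
      using der2_exponential[OF \<Psi>(2)] by (simp add: P(1) algebra_simps)
    then show ?thesis using \<Psi>(1) by simp
  qed
  have \<phi>: "\<phi> \<in> F_curve" and U: "j u \<in> j ` K"
    using \<open>\<phi> \<in> K\<Gamma>\<close> K(3) K\<Gamma> by auto
  obtain \<Psi>' \<phi>' where \<Psi>': "\<Psi>' \<in> adjoin F_curve \<Psi>" "\<Psi>' \<noteq> 0" "\<partial> \<Psi>' = \<phi>' * \<Psi>'" "\<phi>' \<noteq> \<phi>"
    "\<partial> \<phi>' + \<phi>' ^ 2 = j u - lam"
    using conjugate_solution[OF \<phi> U riccati \<Psi>] .
  have ring: "is_subring F_curve" by (rule subfield_closed(1)[OF subfield_F_curve])
  note sub = subset_adjoin[OF ring, of \<Psi>]
  have "\<partial> \<Psi> \<in> adjoin F_curve \<Psi>"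
    unfolding \<Psi>(2) using \<phi> sub subring_closed(4)[OF subfield_closed(1)[OF subfield_adjoin[OF ring]]]
    by blast
  then have dE: "diff_subfield (adjoin F_curve \<Psi>)"
    and E: "diff_field_gen (F_curve \<union> {\<Psi>}) = adjoin F_curve \<Psi>"
    using diff_subfield_adjoin diff_field_gen_insert diff_subfield_F_curve by blast+
  have E': "adjoin F_curve \<Psi> = diff_field_gen (F_curve \<union> {\<Psi>, \<Psi>'})"
  proof
    show "adjoin F_curve \<Psi> \<subseteq> diff_field_gen (F_curve \<union> {\<Psi>, \<Psi>'})"
      unfolding E[symmetric]
      using subset_diff_field_gen[of "F_curve \<union> {\<Psi>, \<Psi>'}"]
      by (intro diff_field_gen_minimal diff_subfield_gen) auto
    show "diff_field_gen (F_curve \<union> {\<Psi>, \<Psi>'}) \<subseteq> adjoin F_curve \<Psi>"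
      using sub \<Psi>'(1) by (intro diff_field_gen_minimal dE) auto
  qed
  have fund: "fundamental_set ?P {\<Psi>, \<Psi>'}"
    by (rule fundamental_set_exponentials[OF \<Psi> \<Psi>'(2-4) P(2) sol[OF \<Psi>(2) riccati] sol[OF \<Psi>'(3,5)]])
  have const: "constants (adjoin F_curve \<Psi>) = constants F_curve"
    by (rule constants_adjoin_exponential[OF diff_subfield_F_curve \<phi> \<Psi>(2,1)
          riccati_no_exponentials[OF \<phi> U riccati]])
  show ?thesis
    unfolding K\<Gamma> C\<Gamma> E spectral_picard_vessiot_def
    using dE sub(1) fund E' const constants_F_curve by blast
qed

end
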